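(* (1) The block sizes statistic $\mathrm{Bk}$ is shuffle-compatible on set partitions. (2) The linear map on $\mathcal{A}^{\Psi}_{\mathrm{Bk}}$ defined by $[\pi]^\Psi_{\mathrm{Bk}}\mapsto\frac{1}{|\pi|!}h_{\lambda(\mathrm{Bk}(\pi))}$ is an algebra isomorphism between $\mathcal{A}^{\Psi}_{\mathrm{Bk}}$ and $\mathrm{Sym}$.
   Context: All algebras are over $\mathbb{Q}$; $\mathrm{Sym}$ is the algebra of symmetric functions and $h_\lambda=h_{\lambda_1}h_{\lambda_2}\cdots$ its complete homogeneous basis. $\Psi$ is the set of all set partitions of finite subsets of $\{1,2,3,\dots\}$; for $\pi\in\Psi$ a partition of $I$ (written $\pi\vdash I$), $|\pi|=|I|$. Set partitions $\tau\vdash I,\theta\vdash J$ are disjoint if $I\cap J=\emptyset$. For $\pi\vdash\{i_1<\dots<i_n\}$ and $S=\{s_1<\dots<s_n\}$, $\mathrm{shift}_S(\pi)$ is the set partition of $S$ obtained by replacing each $i_j$ by $s_j$; $\mathrm{std}(\pi)=\mathrm{shift}_{[n]}(\pi)$. For disjoint $\tau\vdash I,\theta\vdash J$ the arc-shuffle is the multiset (indexed by $S$) $\mathrm{ASh}(\tau,\theta)=\{\{\mathrm{shift}_S(\tau)\cup\mathrm{shift}_{(I\cup J)\setminus S}(\theta):S\subseteq I\cup J,|S|=|I|\}\}$. If $\pi$ has blocks $B_1,\dots,B_k$, $\mathrm{Bk}(\pi)$ is the multiset $\{\{|B_1|,\dots,|B_k|\}\}$, and $\lambda(\mathrm{Bk}(\pi))$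 is the integer partition whose parts are the elements of this multiset. A statistic $\mathrm{st}$ on $\Psi$ is shuffle-compatible on set partitions if (i) for all disjoint $\tau,\theta\in\Psi$ the multiset $\{\{\mathrm{st}(\pi):\pi\in\mathrm{ASh}(\tau,\theta)\}\}$ is determined by $\mathrm{st}(\tau),\mathrm{st}(\theta),|\tau|,|\theta|$; and (ii) $\mathrm{std}(\tau)=\mathrm{std}(\theta)$ implies $\mathrm{st}(\tau)=\mathrm{st}(\theta)$. With $[\pi]^\Psi_{\mathrm{st}}=\{\tau\in\Psi:\mathrm{st}(\tau)=\mathrm{st}(\pi),|\tau|=|\pi|\}$, $\mathcal{A}^\Psi_{\mathrm{st}}$ is the algebra with basis these classes and product $[\tau]^\Psi_{\mathrm{st}}[\theta]^\Psi_{\mathrm{st}}=\sum_{\pi\in\mathrm{ASh}(\tau,\theta)}[\pi]^\Psi_{\mathrm{st}}$ (with multiplicity), for disjoint representatives $\tau,\theta$. *)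

theory Defs
  imports
    "HOL-Library.Multiset"
    "HOL-Library.Disjoint_Sets"
    "HOL-Algebra.Module"
    "HOL-Algebra.QuotRing"
    "HOL-Algebra.Algebraic_Closure_Type"
begin

section \<open>Algebras over the rationals and their maps\<close>

abbreviation rat_field :: "rat ring"  (\<open>\<rat>\<^sub>F\<close>)
  where "\<rat>\<^sub>F \<equiv> ring_of_type_algebra"

definition linear_map ::
    "('k, 'm) ring_scheme \<Rightarrow> ('k, 'a, 'n) module_scheme \<Rightarrow> ('k, 'b, 'o) module_scheme
      \<Rightarrow> ('a \<Rightarrow> 'b) \<Rightarrow> bool"
  where "linear_map K V W \<phi> \<longleftrightarrow>
    \<phi> \<in> carrier V \<rightarrow> carrier W \<and>
    (\<forall>x\<in>carrier V. \<forall>y\<in>carrier V. \<phi> (x \<oplus>\<^bsub>V\<^esub> y) = \<phi> x \<oplus>\<^bsub>W\<^esub> \<phi> y) \<and>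
    (\<forall>c\<in>carrier K. \<forall>x\<in>carrier V. \<phi> (c \<odot>\<^bsub>V\<^esub> x) = c \<odot>\<^bsub>W\<^esub> \<phi> x)"

text \<open>Both sides are required to be (associative, commutative, unital) algebras.\<close>

definition algebra_iso ::
    "('k, 'm) ring_scheme \<Rightarrow> ('k, 'a, 'n) module_scheme \<Rightarrow> ('k, 'b, 'o) module_scheme
      \<Rightarrow> ('a \<Rightarrow> 'b) \<Rightarrow> bool"
  where "algebra_iso K A B \<phi> \<longleftrightarrow>
    algebra K A \<and> algebra K B \<and> linear_map K A B \<phi> \<and> \<phi> \<in> ring_iso A B"


section \<open>Symmetric functions\<close>

text \<open>
  A monomial in the variables \<open>x\<^sub>0, x\<^sub>1, x\<^sub>2, \<dots>\<close> is the multiset of its variable indices: its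
  degree is the size of the multiset, the product of monomials is the sum of multisets, and
  a permutation of the variables acts by taking images. A formal power series in these
  variables is its family of coefficients.
\<close>

type_synonym power_series = "nat multiset \<Rightarrow> rat"

definition ps_mult :: "power_series \<Rightarrow> power_series \<Rightarrow> power_series"
  where "ps_mult f g = (\<lambda>m. \<Sum>a | a \<subseteq># m. f a * g (m - a))"

definition ps_symmetric :: "power_series \<Rightarrow> bool"
  where "ps_symmetric f \<longleftrightarrow> (\<forall>\<sigma> m. bij \<sigma> \<longrightarrow> f (image_mset \<sigma> m) = f m)"

definition ps_bounded_degree :: "power_series \<Rightarrow> bool"
  where "ps_bounded_degree f \<longleftrightarrow> (\<exists>d. \<forall>m. f m \<noteq> 0 \<longrightarrow> size m \<le> d)"

definition Sym :: "(rat, power_series) module"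
  where "Sym = \<lparr>
    carrier = {f. ps_symmetric f \<and> ps_bounded_degree f},
    monoid.mult = ps_mult,
    one = (\<lambda>m. if m = {#} then 1 else 0),
    ring.zero = (\<lambda>m. 0),
    add = (\<lambda>f g m. f m + g m),
    module.smult = (\<lambda>c f m. c * f m)\<rparr>"

text \<open>The complete homogeneous function of degree \<open>n\<close> is the sum of all monomials of degree \<open>n\<close>.\<close>

definition h_fun :: "nat \<Rightarrow> power_series"
  where "h_fun n = (\<lambda>m. if size m = n then 1 else 0)"

definition h_part :: "nat list \<Rightarrow> power_series"
  where "h_part ps = foldr (\<lambda>n f. h_fun n \<otimes>\<^bsub>Sym\<^esub> f) ps \<one>\<^bsub>Sym\<^esub>"


section \<open>Set partitions and the arc-shuffle\<close>

text \<open>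
  The underlying set of \<open>\<pi> \<in> \<Psi>\<close> is \<open>\<Union>\<pi>\<close>. The empty partition of the empty set belongs to \<open>\<Psi>\<close>.
\<close>

definition set_partitions :: "nat set set set"  (\<open>\<Psi>\<close>)
  where "\<Psi> = {\<pi>. \<exists>I. finite I \<and> I \<subseteq> {1..} \<and> partition_on I \<pi>}"

definition sp_size :: "nat set set \<Rightarrow> nat"
  where "sp_size \<pi> = card (\<Union>\<pi>)"

definition disjoint_partitions :: "nat set set \<Rightarrow> nat set set \<Rightarrow> bool"
  where "disjoint_partitions \<tau> \<theta> \<longleftrightarrow> \<Union>\<tau> \<inter> \<Union>\<theta> = {}"

text \<open>
  For \<open>i \<in> I\<close>, the number of elements of \<open>I\<close> below \<open>i\<close> is the (zero-based) position of \<open>i\<close> in the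
  increasing enumeration of \<open>I\<close>.
\<close>

definition shift :: "nat set \<Rightarrow> nat set set \<Rightarrow> nat set set"
  where "shift S \<pi> =
    (\<lambda>B. (\<lambda>i. sorted_list_of_set S ! card {k \<in> \<Union>\<pi>. k < i}) ` B) ` \<pi>"

definition std :: "nat set set \<Rightarrow> nat set set"
  where "std \<pi> = shift {1..sp_size \<pi>} \<pi>"

definition ASh :: "nat set set \<Rightarrow> nat set set \<Rightarrow> nat set set multiset"
  where "ASh \<tau> \<theta> =
    {# shift S \<tau> \<union> shift ((\<Union>\<tau> \<union> \<Union>\<theta>) - S) \<theta>.
       S \<in># mset_set {S. S \<subseteq> \<Union>\<tau> \<union> \<Union>\<theta> \<and> card S = sp_size \<tau>} #}"


section \<open>Shuffle-compatible statistics and their shuffle algebras\<close>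

definition shuffle_compatible :: "(nat set set \<Rightarrow> 'b) \<Rightarrow> bool"
  where "shuffle_compatible st \<longleftrightarrow>
    (\<forall>\<tau>\<in>\<Psi>. \<forall>\<theta>\<in>\<Psi>. \<forall>\<tau>'\<in>\<Psi>. \<forall>\<theta>'\<in>\<Psi>.
       disjoint_partitions \<tau> \<theta> \<and> disjoint_partitions \<tau>' \<theta>' \<and>
       st \<tau> = st \<tau>' \<and> st \<theta> = st \<theta>' \<and> sp_size \<tau> = sp_size \<tau>' \<and> sp_size \<theta> = sp_size \<theta>' \<longrightarrow>
       image_mset st (ASh \<tau> \<theta>) = image_mset st (ASh \<tau>' \<theta>')) \<and>
    (\<forall>\<tau>\<in>\<Psi>. \<forall>\<theta>\<in>\<Psi>. std \<tau> = std \<theta> \<longrightarrow> st \<tau> = st \<theta>)"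

definition st_class :: "(nat set set \<Rightarrow> 'b) \<Rightarrow> nat set set \<Rightarrow> nat set set set"
  where "st_class st \<pi> = {\<tau>\<in>\<Psi>. st \<tau> = st \<pi> \<and> sp_size \<tau> = sp_size \<pi>}"

text \<open>
  Elements of the shuffle algebra are finitely supported rational functions on the set of
  classes; \<open>basis_vec st \<pi>\<close> is the basis element given by the class of \<open>\<pi>\<close>.
\<close>

type_synonym class_vec = "nat set set set \<Rightarrow> rat"

definition basis_vec :: "(nat set set \<Rightarrow> 'b) \<Rightarrow> nat set set \<Rightarrow> class_vec"
  where "basis_vec st \<pi> = (\<lambda>E. if E = st_class st \<pi> then 1 else 0)"

text \<open>
  The product of two classes, computed with an arbitrary choice of disjoint representatives.
  For a shuffle-compatible statistic the choice is irrelevant, see \<open>basis_vec_mult\<close> below.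
\<close>

definition class_mult ::
    "(nat set set \<Rightarrow> 'b) \<Rightarrow> nat set set set \<Rightarrow> nat set set set \<Rightarrow> class_vec"
  where "class_mult st C D =
    (let (\<tau>, \<theta>) = (SOME (\<tau>, \<theta>). \<tau> \<in> C \<and> \<theta> \<in> D \<and> disjoint_partitions \<tau> \<theta>)
     in (\<lambda>E. \<Sum>\<pi>\<in>#ASh \<tau> \<theta>. basis_vec st \<pi> E))"

definition shuffle_algebra :: "(nat set set \<Rightarrow> 'b) \<Rightarrow> (rat, class_vec) module"
  where "shuffle_algebra st = \<lparr>
    carrier = {f. finite {C. f C \<noteq> 0} \<and> {C. f C \<noteq> 0} \<subseteq> st_class st ` \<Psi>},
    monoid.mult = (\<lambda>f g E. \<Sum>C | f C \<noteq> 0. \<Sum>D | g D \<noteq> 0. f C * g D * class_mult st C D E),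
    one = basis_vec st {},
    ring.zero = (\<lambda>E. 0),
    add = (\<lambda>f g E. f E + g E),
    module.smult = (\<lambda>c f E. c * f E)\<rparr>"

lemma Union_shift:
  assumes "finite (\<Union>\<pi>)" "finite S" "card S = sp_size \<pi>"
  shows "\<Union>(shift S \<pi>) = S"
proof -
  let ?I = "\<Union>\<pi>"
  let ?pos = "\<lambda>i. card {k \<in> ?I. k < i}"
  have mono: "?pos i < ?pos j" if "i \<in> ?I" "i < j" for i j
    by (rule psubset_card_mono) (use that assms(1) in auto)
  have "inj_on ?pos ?I"
    by (rule linorder_inj_onI') (use mono in force)
  moreover have "?pos ` ?I \<subseteq> {..<card ?I}"
    using assms(1) by (auto intro!: psubset_card_mono)
  ultimately have pos: "?pos ` ?I = {..<card ?I}"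
    by (intro card_subset_eq) (auto simp: card_image)
  have "\<Union>(shift S \<pi>) = (!) (sorted_list_of_set S) ` ?pos ` ?I"
    unfolding shift_def by auto
  also have "\<dots> = (!) (sorted_list_of_set S) ` {..<length (sorted_list_of_set S)}"
    using assms(3) by (simp only: pos sp_size_def length_sorted_list_of_set)
  also have "\<dots> = S"
    using assms(2) by (simp only: lessThan_atLeast0 nth_image take_all set_sorted_list_of_set order_refl)
  finally show ?thesis .
qed

lemma finite_Union_set_partitions: "\<pi> \<in> \<Psi> \<Longrightarrow> finite (\<Union>\<pi>)"
  by (auto simp: set_partitions_def partition_on_def)

lemma sp_size_ASh:
  assumes "\<tau> \<in> \<Psi>" "\<theta> \<in> \<Psi>" "disjoint_partitions \<tau> \<theta>" "\<pi> \<in># ASh \<tau> \<theta>"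
  shows "sp_size \<pi> = sp_size \<tau> + sp_size \<theta>"
proof -
  let ?U = "\<Union>\<tau> \<union> \<Union>\<theta>"
  have fin: "finite (\<Union>\<tau>)" "finite (\<Union>\<theta>)"
    using assms finite_Union_set_partitions by auto
  then have finS: "finite {S. S \<subseteq> ?U \<and> card S = sp_size \<tau>}"
    by (auto intro: finite_subset[of _ "Pow ?U"])
  obtain S where S: "S \<subseteq> ?U" "card S = sp_size \<tau>"
      and pi: "\<pi> = shift S \<tau> \<union> shift (?U - S) \<theta>"
    using assms(4) finS unfolding ASh_def by auto
  have U: "card ?U = sp_size \<tau> + sp_size \<theta>"
    using fin assms(3) by (simp add: card_Un_disjoint disjoint_partitions_def sp_size_def)
  have "finite S"
    using S(1) fin by (meson finite_UnI finite_subset)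
  then have "card (?U - S) = sp_size \<theta>"
    using S U by (simp add: card_Diff_subset)
  then have "\<Union>\<pi> = ?U"
    using Union_shift[of \<tau> S] Union_shift[of \<theta> "?U - S"] fin \<open>finite S\<close> S pi by auto
  then show ?thesis
    using U by (simp add: sp_size_def)
qed

theorem basis_vec_mult:
  assumes "shuffle_compatible st" "\<tau> \<in> \<Psi>" "\<theta> \<in> \<Psi>" "disjoint_partitions \<tau> \<theta>"
  shows "basis_vec st \<tau> \<otimes>\<^bsub>shuffle_algebra st\<^esub> basis_vec st \<theta> =
    (\<lambda>E. \<Sum>\<pi>\<in>#ASh \<tau> \<theta>. basis_vec st \<pi> E)"
proof
  fix E
  let ?C = "st_class st \<tau>" and ?D = "st_class st \<theta>"
  let ?P = "\<lambda>(\<tau>', \<theta>'). \<tau>' \<in> ?C \<and> \<theta>' \<in> ?D \<and> disjoint_partitions \<tau>' \<theta>'"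
  obtain \<tau>' \<theta>' where eq: "(SOME x. ?P x) = (\<tau>', \<theta>')"
    by force
  have "?P (SOME x. ?P x)"
    by (rule someI[of ?P "(\<tau>, \<theta>)"]) (use assms in \<open>auto simp: st_class_def\<close>)
  then have P: "\<tau>' \<in> \<Psi>" "\<theta>' \<in> \<Psi>" "st \<tau>' = st \<tau>" "st \<theta>' = st \<theta>"
      "sp_size \<tau>' = sp_size \<tau>" "sp_size \<theta>' = sp_size \<theta>" "disjoint_partitions \<tau>' \<theta>'"
    unfolding eq by (auto simp: st_class_def)
  then have st: "image_mset st (ASh \<tau>' \<theta>') = image_mset st (ASh \<tau> \<theta>)"
    using assms unfolding shuffle_compatible_def by blast
  define v where
    "v s = (if E = {\<rho>\<in>\<Psi>. st \<rho> = s \<and> sp_size \<rho> = sp_size \<tau> + sp_size \<theta>} then 1 else 0 :: rat)" for s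
  have v: "(\<Sum>\<pi>\<in>#ASh \<alpha> \<beta>. basis_vec st \<pi> E) = sum_mset (image_mset v (image_mset st (ASh \<alpha> \<beta>)))"
    if "\<alpha> \<in> \<Psi>" "\<beta> \<in> \<Psi>" "disjoint_partitions \<alpha> \<beta>" "sp_size \<alpha> = sp_size \<tau>" "sp_size \<beta> = sp_size \<theta>"
    for \<alpha> \<beta>
  proof -
    have "basis_vec st \<pi> E = v (st \<pi>)" if "\<pi> \<in># ASh \<alpha> \<beta>" for \<pi>
      using sp_size_ASh[OF \<open>\<alpha> \<in> \<Psi>\<close> \<open>\<beta> \<in> \<Psi>\<close> \<open>disjoint_partitions \<alpha> \<beta>\<close> that]
        \<open>sp_size \<alpha> = sp_size \<tau>\<close> \<open>sp_size \<beta> = sp_size \<theta>\<close>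
      by (simp add: basis_vec_def st_class_def v_def)
    then show ?thesis
      by (simp add: multiset.map_comp comp_def cong: image_mset_cong)
  qed
  have supp: "{C. basis_vec st \<pi> C \<noteq> 0} = {st_class st \<pi>}" for \<pi>
    by (auto simp: basis_vec_def)
  have "(basis_vec st \<tau> \<otimes>\<^bsub>shuffle_algebra st\<^esub> basis_vec st \<theta>) E = class_mult st ?C ?D E"
    by (simp add: shuffle_algebra_def supp) (simp add: basis_vec_def)
  also have "\<dots> = (\<Sum>\<pi>\<in>#ASh \<tau>' \<theta>'. basis_vec st \<pi> E)"
    by (simp add: class_mult_def eq)
  also have "\<dots> = (\<Sum>\<pi>\<in>#ASh \<tau> \<theta>. basis_vec st \<pi> E)"
    using v[of \<tau>' \<theta>'] v[of \<tau> \<theta>] P assms st by simp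
  finally show "(basis_vec st \<tau> \<otimes>\<^bsub>shuffle_algebra st\<^esub> basis_vec st \<theta>) E =
    (\<Sum>\<pi>\<in>#ASh \<tau> \<theta>. basis_vec st \<pi> E)" .
qed


section \<open>The block sizes statistic\<close>

definition Bk :: "nat set set \<Rightarrow> nat multiset"
  where "Bk \<pi> = image_mset card (mset_set \<pi>)"

text \<open>Integer partitions are weakly decreasing lists.\<close>

definition part_of_mset :: "nat multiset \<Rightarrow> nat list"
  where "part_of_mset M = rev (sorted_list_of_multiset M)"

end

theory Submission
  imports Defs "HOL-Library.Function_Algebras" "HOL-Combinatorics.Permutations"
begin

text \<open>
  The multiset \<open>ASh(\<tau>, \<theta>)\<close> has \<open>(|\<tau>| + |\<theta>| choose |\<tau>|)\<close> elements, all with the block sizes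
  of \<open>\<tau>\<close> and \<open>\<theta>\<close> together; so \<open>Bk\<close> is shuffle-compatible, and dividing by \<open>|\<pi>|!\<close> turns the
  product of classes into the product of complete homogeneous functions. It remains to see that the
  \<open>h\<^sub>\<lambda>\<close> form a basis of \<open>Sym\<close>. Newton's identity \<open>n h\<^sub>n = \<Sum>\<^sub>k p\<^sub>k h\<^sub>n\<^sub>-\<^sub>k\<close> puts the power sums
  into the span of the \<open>h\<^sub>\<lambda>\<close>, and the products \<open>p\<^sub>\<lambda>\<close> span \<open>Sym\<close> because they are triangular with
  respect to monomials ordered by their number of distinct variables. Independence of the \<open>h\<^sub>\<lambda>\<close> follows
  by counting dimensions in bounded degree. The axioms of an algebra on the shuffle algebra are pulled back
  from \<open>Sym\<close> along the resulting injection.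
\<close>

section \<open>The ring of symmetric functions\<close>

definition fscale :: "rat \<Rightarrow> ('a \<Rightarrow> rat) \<Rightarrow> 'a \<Rightarrow> rat"
  where "fscale c f = (\<lambda>x. c * f x)"

lemma fscale_apply [simp]: "fscale c f x = c * f x"
  by (simp add: fscale_def)

text \<open>Power series and elements of the shuffle algebra are both rational-valued functions, so
  one pointwise structure supplies spans, subspaces and independence on both sides.\<close>

interpretation fspace: vector_space fscale
  by standard (auto simp: fun_eq_iff algebra_simps)

lemma sum_fun_apply: "(\<Sum>i\<in>I. f i) x = (\<Sum>i\<in>I. f i x)" for f :: "'i \<Rightarrow> 'a \<Rightarrow> rat"
  by (induction I rule: infinite_finite_induct) auto

text \<open>Makes the sum defining \<open>ps_mult\<close> a genuine finite one; a \<open>sum\<close>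
  over an infinite set would be 0 by default.\<close>

lemma finite_submsets [simp]: "finite {a. a \<subseteq># m}"
proof (induction m)
  case (add x m)
  have "{a. a \<subseteq># add_mset x m} \<subseteq> {a. a \<subseteq># m} \<union> add_mset x ` {a. a \<subseteq># m}"
  proof
    fix a assume "a \<in> {a. a \<subseteq># add_mset x m}"
    then have a: "a \<subseteq># add_mset x m" by simp
    show "a \<in> {a. a \<subseteq># m} \<union> add_mset x ` {a. a \<subseteq># m}"
    proof (cases "x \<in># a")
      case True
      then obtain b where "a = add_mset x b" by (metis insert_DiffM)
      then show ?thesis using a by auto
    next
      case False
      then have "a \<subseteq># m" using a
        by (metis add_mset_remove_trivial diff_single_trivial subset_eq_diff_conv add_mset_add_single)
      then show ?thesis by simp
    qed
  qed
  then show ?case using add finite_subset by blast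
qed auto

section \<open>The product of power series\<close>

abbreviation ps_one :: power_series
  where "ps_one \<equiv> \<lambda>m. if m = {#} then 1 else 0"

lemma ps_mult_commute: "ps_mult f g = ps_mult g f"
proof
  fix m
  show "ps_mult f g m = ps_mult g f m"
    unfolding ps_mult_def
    by (rule sum.reindex_bij_witness[of _ "\<lambda>a. m - a" "\<lambda>a. m - a"])
      (auto simp: double_diff mult.commute subset_mset.diff_diff_right)
qed

lemma ps_mult_assoc: "ps_mult (ps_mult f g) h = ps_mult f (ps_mult g h)"
proof
  fix m
  have "ps_mult (ps_mult f g) h m =
    (\<Sum>(a, b)\<in>(SIGMA a:{a. a \<subseteq># m}. {b. b \<subseteq># a}). f b * g (a - b) * h (m - a))"
    by (simp add: ps_mult_def sum_distrib_right sum.Sigma)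
  \<comment> \<open>Both sums run over the ways to split m into three factors. The first records a
    nested pair b \<subseteq> a, the second the first two factors b and c = a - b.\<close>
  also have "\<dots> = (\<Sum>(b, c)\<in>(SIGMA b:{b. b \<subseteq># m}. {c. c \<subseteq># m - b}). f b * (g c * h (m - b - c)))"
    by (rule sum.reindex_bij_witness[of _ "\<lambda>(b, c). (b + c, b)" "\<lambda>(a, b). (b, a - b)"])
      (auto simp: subset_mset.le_diff_conv2 add.commute mult.assoc subset_mset.add_diff_inverse
        intro: subset_eq_diff_conv subset_mset.order_trans)
  also have "\<dots> = ps_mult f (ps_mult g h) m"
    by (simp add: ps_mult_def sum_distrib_left sum.Sigma)
  finally show "ps_mult (ps_mult f g) h m = ps_mult f (ps_mult g h) m" .
qed

lemma ps_mult_one_left [simp]: "ps_mult ps_one f = f"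
proof
  fix m
  have "ps_mult ps_one f m = (\<Sum>a | a \<subseteq># m. if a = {#} then f m else 0)"
    unfolding ps_mult_def by (intro sum.cong) auto
  then show "ps_mult ps_one f m = f m" by simp
qed

text \<open>Provides \<open>ps.F\<close>, the product over a multiset of power series, for which no
  order of the factors has to be chosen.\<close>

interpretation ps: comm_monoid_mset ps_mult ps_one
  by standard (simp_all add: ps_mult_assoc ps_mult_commute[of _ ps_one], rule ps_mult_commute)

lemma ps_mult_add_left: "ps_mult (f + g) h = ps_mult f h + ps_mult g h"
  by (auto simp: fun_eq_iff ps_mult_def sum.distrib distrib_right)

lemma ps_mult_scale_left: "ps_mult (fscale c f) h = fscale c (ps_mult f h)"
  by (auto simp: fun_eq_iff ps_mult_def sum_distrib_left mult.assoc)

lemma ps_mult_scale_right: "ps_mult h (fscale c f) = fscale c (ps_mult h f)"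
  by (metis ps_mult_commute ps_mult_scale_left)

lemma ps_mult_zero_left [simp]: "ps_mult 0 h = 0"
  by (auto simp: fun_eq_iff ps_mult_def)

lemma ps_mult_sum_left: "ps_mult (\<Sum>i\<in>I. f i) h = (\<Sum>i\<in>I. ps_mult (f i) h)"
  by (induction I rule: infinite_finite_induct)
    (simp_all only: sum.infinite sum.empty sum.insert ps_mult_add_left ps_mult_zero_left not_False_eq_True)

lemma ps_mult_sum_right: "ps_mult h (\<Sum>i\<in>I. f i) = (\<Sum>i\<in>I. ps_mult h (f i))"
  by (simp add: ps_mult_commute[of h] ps_mult_sum_left)

lemma ps_mult_nonzeroD:
  assumes "ps_mult f g m \<noteq> 0"
  obtains a where "a \<subseteq># m" "f a \<noteq> 0" "g (m - a) \<noteq> 0"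
proof -
  have "\<exists>a\<in>{a. a \<subseteq># m}. f a * g (m - a) \<noteq> 0"
    using assms unfolding ps_mult_def by (metis (no_types, lifting) sum.neutral)
  then show thesis using that by auto
qed

section \<open>Closure properties of symmetric functions\<close>

lemma Sym_simps [simp]:
  "f \<in> carrier Sym \<longleftrightarrow> ps_symmetric f \<and> ps_bounded_degree f"
  "f \<otimes>\<^bsub>Sym\<^esub> g = ps_mult f g"
  "\<one>\<^bsub>Sym\<^esub> = ps_one"
  "\<zero>\<^bsub>Sym\<^esub> = 0"
  "f \<oplus>\<^bsub>Sym\<^esub> g = f + g"
  "c \<odot>\<^bsub>Sym\<^esub> f = fscale c f"
  by (auto simp: Sym_def fun_eq_iff)

lemma ps_symmetricD: "ps_symmetric f \<Longrightarrow> bij \<sigma> \<Longrightarrow> f (image_mset \<sigma> m) = f m"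
  by (simp add: ps_symmetric_def)

text \<open>A bijection \<sigma> maps the factorisations of m bijectively onto those of its image,
  and it respects complements.\<close>

lemma ps_symmetric_mult:
  assumes "ps_symmetric f" "ps_symmetric g"
  shows "ps_symmetric (ps_mult f g)"
  unfolding ps_symmetric_def
proof safe
  fix \<sigma> :: "nat \<Rightarrow> nat" and m
  assume \<sigma>: "bij \<sigma>"
  have inv: "image_mset (Hilbert_Choice.inv \<sigma>) (image_mset \<sigma> a) = a" "image_mset \<sigma> (image_mset (Hilbert_Choice.inv \<sigma>) a) = a" for a
    using \<sigma> by (simp_all add: multiset.map_comp comp_def bij_is_inj bij_is_surj surj_f_inv_f)
  show "ps_mult f g (image_mset \<sigma> m) = ps_mult f g m"
    unfolding ps_mult_def
  proof (rule sum.reindex_bij_witness[of _ "image_mset \<sigma>" "image_mset (Hilbert_Choice.inv \<sigma>)"]; (simp add: inv)?)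
    fix a assume "a \<subseteq># image_mset \<sigma> m"
    then show sub: "image_mset (Hilbert_Choice.inv \<sigma>) a \<subseteq># m"
      using image_mset_subseteq_mono[of a "image_mset \<sigma> m" "Hilbert_Choice.inv \<sigma>"] by (simp only: inv)
    have "image_mset \<sigma> m - a = image_mset \<sigma> (m - image_mset (Hilbert_Choice.inv \<sigma>) a)"
      using image_mset_Diff[OF sub, of \<sigma>] by (simp only: inv)
    then show "f (image_mset (Hilbert_Choice.inv \<sigma>) a) * g (m - image_mset (Hilbert_Choice.inv \<sigma>) a) = f a * g (image_mset \<sigma> m - a)"
      using ps_symmetricD[OF assms(1) \<sigma>, of "image_mset (Hilbert_Choice.inv \<sigma>) a"] ps_symmetricD[OF assms(2) \<sigma>]
      by (simp only: inv)
  qed (auto intro: image_mset_subseteq_mono)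
qed

lemma ps_bounded_degree_mult:
  assumes "ps_bounded_degree f" "ps_bounded_degree g"
  shows "ps_bounded_degree (ps_mult f g)"
proof -
  obtain d e where d: "\<And>m. f m \<noteq> 0 \<Longrightarrow> size m \<le> d" and e: "\<And>m. g m \<noteq> 0 \<Longrightarrow> size m \<le> e"
    using assms unfolding ps_bounded_degree_def by blast
  have "size m \<le> d + e" if "ps_mult f g m \<noteq> 0" for m
    using that by (elim ps_mult_nonzeroD) (use d e size_Diff_submset in fastforce)
  then show ?thesis unfolding ps_bounded_degree_def by blast
qed

lemma ps_bounded_degree_add:
  assumes "ps_bounded_degree f" "ps_bounded_degree g"
  shows "ps_bounded_degree (f + g)"
proof -
  obtain d e where d: "\<And>m. f m \<noteq> 0 \<Longrightarrow> size m \<le> d" and e: "\<And>m. g m \<noteq> 0 \<Longrightarrow> size m \<le> e"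
    using assms unfolding ps_bounded_degree_def by blast
  have "size m \<le> max d e" if "(f + g) m \<noteq> 0" for m
    using that d[of m] e[of m] by (cases "f m = 0") auto
  then show ?thesis unfolding ps_bounded_degree_def by blast
qed

lemma subspace_Sym: "fspace.subspace (carrier Sym)"
  unfolding fspace.subspace_def
proof (intro conjI ballI allI)
  show "0 \<in> carrier Sym" by (auto simp: ps_symmetric_def ps_bounded_degree_def)
next
  fix f g assume "f \<in> carrier Sym" "g \<in> carrier Sym"
  then show "f + g \<in> carrier Sym"
    by (auto intro: ps_bounded_degree_add) (simp add: ps_symmetric_def)
next
  fix c f assume "f \<in> carrier Sym"
  then show "fscale c f \<in> carrier Sym"
    by (auto simp: ps_symmetric_def ps_bounded_degree_def)
qed

lemma one_in_Sym: "ps_one \<in> carrier Sym"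
  by (auto simp: ps_symmetric_def ps_bounded_degree_def)

lemma mult_in_Sym: "f \<in> carrier Sym \<Longrightarrow> g \<in> carrier Sym \<Longrightarrow> ps_mult f g \<in> carrier Sym"
  by (simp add: ps_symmetric_mult ps_bounded_degree_mult)

section \<open>Algebra axioms on subspaces of function spaces\<close>

lemma rat_field_simps [simp]:
  "carrier \<rat>\<^sub>F = UNIV" "a \<oplus>\<^bsub>\<rat>\<^sub>F\<^esub> b = a + b" "a \<otimes>\<^bsub>\<rat>\<^sub>F\<^esub> b = a * b" "\<one>\<^bsub>\<rat>\<^sub>F\<^esub> = 1"
  by (auto simp: ring_of_type_algebra_def)

lemma abelian_group_subspaceI:
  fixes V :: "('a \<Rightarrow> rat, 'n) ring_scheme"
  assumes V: "fspace.subspace (carrier V)"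
    and ops: "\<And>f g. f \<oplus>\<^bsub>V\<^esub> g = f + g" "\<zero>\<^bsub>V\<^esub> = 0"
  shows "abelian_group V"
proof (rule abelian_groupI)
  fix f assume "f \<in> carrier V"
  then show "\<exists>g\<in>carrier V. g \<oplus>\<^bsub>V\<^esub> f = \<zero>\<^bsub>V\<^esub>"
    using fspace.subspace_neg[OF V] by (intro bexI[of _ "- f"]) (auto simp: ops)
qed (use fspace.subspace_add[OF V] fspace.subspace_0[OF V] in \<open>auto simp: ops algebra_simps\<close>)

text \<open>With pointwise addition and scaling the module axioms are automatic, so only the laws of
  the product remain. Serves both \<open>Sym\<close> and the shuffle algebra.\<close>

lemma algebra_subspaceI:
  fixes V :: "(rat, 'a \<Rightarrow> rat, 'n) module_scheme"
  assumes V: "fspace.subspace (carrier V)"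
    and ops: "\<And>f g. f \<oplus>\<^bsub>V\<^esub> g = f + g" "\<zero>\<^bsub>V\<^esub> = 0" "\<And>c f. c \<odot>\<^bsub>V\<^esub> f = fscale c f"
    and closed: "\<And>f g. f \<in> carrier V \<Longrightarrow> g \<in> carrier V \<Longrightarrow> f \<otimes>\<^bsub>V\<^esub> g \<in> carrier V" "\<one>\<^bsub>V\<^esub> \<in> carrier V"
    and assoc: "\<And>f g h. f \<in> carrier V \<Longrightarrow> g \<in> carrier V \<Longrightarrow> h \<in> carrier V \<Longrightarrow>
      (f \<otimes>\<^bsub>V\<^esub> g) \<otimes>\<^bsub>V\<^esub> h = f \<otimes>\<^bsub>V\<^esub> (g \<otimes>\<^bsub>V\<^esub> h)"
    and comm: "\<And>f g. f \<in> carrier V \<Longrightarrow> g \<in> carrier V \<Longrightarrow> f \<otimes>\<^bsub>V\<^esub> g = g \<otimes>\<^bsub>V\<^esub> f"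
    and one: "\<And>f. f \<in> carrier V \<Longrightarrow> \<one>\<^bsub>V\<^esub> \<otimes>\<^bsub>V\<^esub> f = f"
    and distr: "\<And>f g h. f \<in> carrier V \<Longrightarrow> g \<in> carrier V \<Longrightarrow> h \<in> carrier V \<Longrightarrow>
      (f + g) \<otimes>\<^bsub>V\<^esub> h = f \<otimes>\<^bsub>V\<^esub> h + g \<otimes>\<^bsub>V\<^esub> h"
    and scale: "\<And>c f g. f \<in> carrier V \<Longrightarrow> g \<in> carrier V \<Longrightarrow>
      fscale c f \<otimes>\<^bsub>V\<^esub> g = fscale c (f \<otimes>\<^bsub>V\<^esub> g)"
  shows "algebra \<rat>\<^sub>F V"
proof (rule algebraI)
  show "cring \<rat>\<^sub>F" by (rule cring_from_type_algebra)
  show "cring V"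
  proof (rule cringI)
    show "abelian_group V" by (rule abelian_group_subspaceI[OF V ops(1,2)])
    show "comm_monoid V" by (rule comm_monoidI) (use closed assoc comm one in auto)
  qed (use distr ops in auto)
qed (simp_all add: ops scale fspace.subspace_scale[OF V] fspace.scale_left_distrib
    fspace.scale_right_distrib)

lemma algebra_Sym: "algebra \<rat>\<^sub>F Sym"
  by (rule algebra_subspaceI[OF subspace_Sym])
    (use one_in_Sym mult_in_Sym in
      \<open>auto simp: ps_mult_assoc ps_mult_add_left ps_mult_scale_left intro: ps_mult_commute\<close>)

section \<open>The basis of complete homogeneous functions\<close>

text \<open>Multisets as indices make the product rule a sum of indices. Zero parts are harmless
  here, since \<open>h_fun 0\<close> is the unit.\<close>

definition h_mset :: "nat multiset \<Rightarrow> power_series"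
  where "h_mset M = ps.F (image_mset h_fun M)"

text \<open>The power sum only for \<open>k > 0\<close>: \<open>p_fun 0\<close> is the constant 1.\<close>

definition p_fun :: "nat \<Rightarrow> power_series"
  where "p_fun k = (\<lambda>m. if \<exists>i. m = replicate_mset k i then 1 else 0)"

definition p_mset :: "nat multiset \<Rightarrow> power_series"
  where "p_mset M = ps.F (image_mset p_fun M)"

text \<open>The exponent type of a monomial: the integer partition that labels its orbit under
  permutations of the variables.\<close>

definition shape :: "nat multiset \<Rightarrow> nat multiset"
  where "shape m = image_mset (count m) (mset_set (set_mset m))"

lemma h_mset_simps [simp]:
  "h_mset {#} = ps_one" "h_mset (add_mset n M) = ps_mult (h_fun n) (h_mset M)"
  "h_mset (M + N) = ps_mult (h_mset M) (h_mset N)"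
  by (simp_all add: h_mset_def)

lemma p_mset_simps [simp]:
  "p_mset {#} = ps_one" "p_mset (add_mset n M) = ps_mult (p_fun n) (p_mset M)"
  by (simp_all add: p_mset_def)

lemma h_part_eq: "h_part ps = h_mset (mset ps)"
  by (induction ps) (simp_all add: h_part_def)

lemma h_fun_in_Sym: "h_fun n \<in> carrier Sym"
  by (auto simp: ps_symmetric_def ps_bounded_degree_def h_fun_def)

lemma h_mset_in_Sym: "h_mset M \<in> carrier Sym"
  by (induction M) (use one_in_Sym mult_in_Sym[OF h_fun_in_Sym] in simp_all)

lemma h_mset_homogeneous: "h_mset M m \<noteq> 0 \<Longrightarrow> size m = sum_mset M"
proof (induction M arbitrary: m)
  case (add n M)
  then obtain a where "a \<subseteq># m" "h_fun n a \<noteq> 0" "h_mset M (m - a) \<noteq> 0"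
    by (auto elim: ps_mult_nonzeroD)
  then show ?case
    using add.IH[of "m - a"] size_mset_mono[of a m]
    by (auto simp: h_fun_def size_Diff_submset split: if_splits)
qed (simp split: if_splits)

section \<open>Newton's identity\<close>

text \<open>Each variable i contributes its powers with exponents from 1 to
  \<open>count m i\<close>, and these counts add up to the degree of m.\<close>

lemma sum_replicate_submsets:
  "(\<Sum>a | a \<subseteq># m. if \<exists>k\<ge>1. \<exists>i. a = replicate_mset k i then 1 else 0) = (of_nat (size m) :: rat)"
proof -
  have "{a. a \<subseteq># m \<and> (\<exists>k\<ge>1. \<exists>i. a = replicate_mset k i)} =
    (\<lambda>(i, k). replicate_mset k i) ` (SIGMA i:set_mset m. {1..count m i})" (is "?A = ?f ` ?B")
  proof safe
    fix k i assume "replicate_mset k i \<subseteq># m" "1 \<le> (k::nat)"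
    then show "replicate_mset k i \<in> ?f ` ?B"
      by (intro image_eqI[of _ _ "(i, k)"])
        (auto simp flip: count_le_replicate_mset_subset_eq count_greater_zero_iff)
  qed (auto simp flip: count_le_replicate_mset_subset_eq)
  \<comment> \<open>Needs exponents at least 1: the zeroth powers of all variables coincide.\<close>
  moreover have "inj_on ?f ?B"
    by (rule inj_onI) (auto simp: replicate_mset_eq_iff)
  ultimately have "card ?A = size m"
    by (simp add: card_image size_multiset_overloaded_eq)
  then show ?thesis
    by (simp add: sum.If_cases Collect_conj_eq)
qed

text \<open>Compared coefficientwise: at a monomial m of degree n the left side counts the
  nontrivial powers of a variable that divide m, and there are n of them.\<close>

lemma newton_identity:
  assumes "n \<ge> 1"
  shows "(\<Sum>k=1..n. ps_mult (p_fun k) (h_fun (n - k))) = fscale (of_nat n) (h_fun n)"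
proof
  fix m
  have "(\<Sum>k=1..n. ps_mult (p_fun k) (h_fun (n - k))) m =
    (\<Sum>a | a \<subseteq># m. \<Sum>k=1..n. p_fun k a * h_fun (n - k) (m - a))"
    unfolding sum_fun_apply ps_mult_def by (rule sum.swap)
  also have "\<dots> = (\<Sum>a | a \<subseteq># m. if size m = n \<and> (\<exists>k\<ge>1. \<exists>i. a = replicate_mset k i) then 1 else 0)"
  proof (rule sum.cong)
    fix a assume "a \<in> {a. a \<subseteq># m}"
    then have a: "a \<subseteq># m" by simp
    then have size: "size (m - a) = size m - size a" "size a \<le> size m"
      by (simp_all add: size_Diff_submset size_mset_mono)
    \<comment> \<open>A power of a variable has its exponent as its size, so only the summand k =
      \<open>size a\<close> can survive; the empty multiset drops out because the sum starts at
      1.\<close>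
    define pw where "pw \<longleftrightarrow> (\<exists>i. a = replicate_mset (size a) i)"
    have p: "p_fun k a = (if k = size a \<and> pw then 1 else 0)" for k
      unfolding p_fun_def pw_def by (metis size_replicate_mset)
    have pw: "(\<exists>k\<ge>1. \<exists>i. a = replicate_mset k i) \<longleftrightarrow> size a \<ge> 1 \<and> pw"
      unfolding pw_def by (metis size_replicate_mset)
    have "(\<Sum>k=1..n. p_fun k a * h_fun (n - k) (m - a)) =
      (\<Sum>k=1..n. if k = size a then (if size m = n \<and> pw then 1 else 0) else 0)"
      using size by (intro sum.cong) (auto simp: p h_fun_def)
    also have "\<dots> = (if size m = n \<and> (\<exists>k\<ge>1. \<exists>i. a = replicate_mset k i) then 1 else 0)"
      unfolding pw using size by auto
    finally show "(\<Sum>k=1..n. p_fun k a * h_fun (n - k) (m - a)) =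
      (if size m = n \<and> (\<exists>k\<ge>1. \<exists>i. a = replicate_mset k i) then 1 else 0)" .
  qed simp
  also have "\<dots> = fscale (of_nat n) (h_fun n) m"
    using sum_replicate_submsets[of m] by (cases "size m = n") (simp_all add: h_fun_def)
  finally show "(\<Sum>k=1..n. ps_mult (p_fun k) (h_fun (n - k))) m = fscale (of_nat n) (h_fun n) m" .
qed

section \<open>Power sums in the span of the complete homogeneous functions\<close>

text \<open>Integer partitions as multisets of parts. The part 0 is excluded because adding it would
  not change \<open>h_mset M\<close>, which would destroy independence.\<close>

abbreviation pos_msets :: "nat multiset set"
  where "pos_msets \<equiv> {M. 0 \<notin># M}"

text \<open>Bilinearity: induction over the second factor for a fixed generator, then over the
  first.\<close>

lemma span_mult:
  assumes "f \<in> fspace.span A" "g \<in> fspace.span B" "\<And>a b. a \<in> A \<Longrightarrow> b \<in> B \<Longrightarrow> ps_mult a b \<in> fspace.span C"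
  shows "ps_mult f g \<in> fspace.span C"
proof -
  have *: "ps_mult a g \<in> fspace.span C" if "a \<in> A" for a
    using assms(2)
  proof (induction rule: fspace.span_induct_alt)
    case base
    have "ps_mult a 0 = 0" by (simp add: ps_mult_commute[of a])
    then show ?case by (simp only: fspace.span_zero)
  next
    case (step c x y)
    have "ps_mult a (fscale c x + y) = fscale c (ps_mult a x) + ps_mult a y"
      by (simp only: ps_mult_commute[of a] ps_mult_add_left ps_mult_scale_left)
    then show ?case using assms(3)[OF that step(1)] step
      by (simp only: fspace.span_add fspace.span_scale)
  qed
  show ?thesis using assms(1)
  proof (induction rule: fspace.span_induct_alt)
    case base
    show ?case by (simp only: ps_mult_zero_left fspace.span_zero)
  next
    case (step c x y)
    then show ?case using *[of x]
      by (simp only: ps_mult_add_left ps_mult_scale_left fspace.span_add fspace.span_scale)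
  qed
qed

lemma h_span_mult:
  "f \<in> fspace.span (h_mset ` pos_msets) \<Longrightarrow> g \<in> fspace.span (h_mset ` pos_msets) \<Longrightarrow>
    ps_mult f g \<in> fspace.span (h_mset ` pos_msets)"
  by (erule span_mult, assumption) (auto intro!: fspace.span_base simp flip: h_mset_simps(3))

lemma h_fun_in_h_span: "h_fun n \<in> fspace.span (h_mset ` pos_msets)"
proof (cases "n = 0")
  case True
  then have "h_fun n = h_mset {#}" by (auto simp: h_fun_def)
  then show ?thesis by (auto intro!: fspace.span_base imageI simp del: h_mset_simps)
next
  case False
  then have "{#n#} \<in> pos_msets" "h_fun n = h_mset {#n#}" by (simp_all add: h_mset_def)
  then show ?thesis by (simp only: fspace.span_base imageI)
qed

text \<open>Newton's identity solved for its summand k = n, which is \<open>p_fun n\<close> because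
  \<open>h_fun 0\<close> is the unit; the other summands involve smaller power sums.\<close>

lemma p_fun_in_h_span: "n \<ge> 1 \<Longrightarrow> p_fun n \<in> fspace.span (h_mset ` pos_msets)"
proof (induction n rule: less_induct)
  case (less n)
  have "h_fun 0 = ps_one" by (auto simp: h_fun_def)
  then have "p_fun n = ps_mult (p_fun n) (h_fun (n - n))"
    by (simp add: ps_mult_commute[of _ ps_one])
  also have "\<dots> = (\<Sum>k=1..n. ps_mult (p_fun k) (h_fun (n - k)))
      - (\<Sum>k\<in>{1..n} - {n}. ps_mult (p_fun k) (h_fun (n - k)))"
    by (subst sum.remove[of "{1..n}" n]) (use less.prems in \<open>simp_all only: finite_atLeastAtMost atLeastAtMost_iff add_diff_cancel_right' order_refl\<close>)
  also have "\<dots> = fscale (of_nat n) (h_fun n) - (\<Sum>k\<in>{1..n} - {n}. ps_mult (p_fun k) (h_fun (n - k)))"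
    by (simp only: newton_identity[OF less.prems])
  also have "\<dots> \<in> fspace.span (h_mset ` pos_msets)"
    by (intro fspace.span_diff fspace.span_scale fspace.span_sum h_fun_in_h_span h_span_mult less.IH) auto
  finally show ?case .
qed

lemma p_mset_in_h_span: "0 \<notin># M \<Longrightarrow> p_mset M \<in> fspace.span (h_mset ` pos_msets)"
proof (induction M)
  case empty
  have "h_mset {#} \<in> fspace.span (h_mset ` pos_msets)" by (intro fspace.span_base imageI) simp
  then show ?case by (simp only: h_mset_simps p_mset_simps)
next
  case (add n M)
  then have "n \<ge> 1" "0 \<notin># M" by auto
  then show ?case unfolding p_mset_simps by (intro h_span_mult p_fun_in_h_span add.IH)
qed

section \<open>Exponent types and orbits of monomials\<close>

lemma shape_empty [simp]: "shape {#} = {#}"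
  by (simp add: shape_def)

lemma size_shape: "size (shape m) = card (set_mset m)"
  by (simp add: shape_def)

lemma sum_shape: "sum_mset (shape m) = size m"
  by (simp add: shape_def size_multiset_overloaded_eq sum_unfold_sum_mset)

lemma shape_pos: "0 \<notin># shape m"
  by (auto simp: shape_def image_iff count_eq_zero_iff eq_commute[of 0])

lemma count_image_mset_inj: "inj \<sigma> \<Longrightarrow> count (image_mset \<sigma> m) (\<sigma> x) = count m x"
  by (induction m) (auto dest: injD)

lemma shape_image:
  assumes "bij \<sigma>"
  shows "shape (image_mset \<sigma> m) = shape m"
proof -
  have inj: "inj \<sigma>" using assms by (rule bij_is_inj)
  then have "mset_set (\<sigma> ` set_mset m) = image_mset \<sigma> (mset_set (set_mset m))"
    by (simp add: image_mset_mset_set inj_on_subset)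
  then show ?thesis
    using inj by (simp add: shape_def multiset.map_comp comp_def count_image_mset_inj)
qed

lemma shape_add_replicate:
  assumes "i \<notin># m" "k > 0"
  shows "shape (replicate_mset k i + m) = add_mset k (shape m)"
proof -
  let ?f = "count (replicate_mset k i + m)"
  have "?f i = k" using assms(1) by (simp add: not_in_iff)
  moreover have "image_mset ?f (mset_set (set_mset m)) = shape m"
    unfolding shape_def using assms(1) by (intro image_mset_cong) auto
  ultimately show ?thesis using assms by (simp add: shape_def[of "replicate_mset k i + m"])
qed

text \<open>Give each part its own fresh variable. This yields a representative monomial for every
  partition.\<close>

lemma shape_surj: "0 \<notin># M \<Longrightarrow> \<exists>m. shape m = M"
proof (induction M)
  case (add k M)
  then obtain m where m: "shape m = M" by auto
  obtain i where "i \<notin># m"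
    using ex_new_if_finite[of "set_mset m"] by auto
  then show ?case using shape_add_replicate[of i m k] m add.prems by auto
qed (auto intro: exI[of _ "{#}"])

text \<open>On the finite set of variables that occur in either monomial, the exponents padded with
  zeros form the same multiset, so a permutation of that set matches them.\<close>

lemma same_shape_imp_permuted:
  assumes "shape m = shape m'"
  obtains \<sigma> where "bij \<sigma>" "image_mset \<sigma> m = m'"
proof -
  let ?A = "set_mset m \<union> set_mset m'"
  \<comment> \<open>Enlarging the set of variables adds one exponent 0 for each variable that does
    not occur.\<close>
  have *: "image_mset (count x) (mset_set B) = shape x + replicate_mset (card B - size (shape x)) 0"
    if "set_mset x \<subseteq> B" "finite B" for x :: "nat multiset" and B
  proof -
    have "mset_set B = mset_set (set_mset x) + mset_set (B - set_mset x)"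
      using mset_set_Union[of "set_mset x" "B - set_mset x"] that by (simp add: Un_absorb1)
    moreover have "image_mset (count x) (mset_set (B - set_mset x)) = image_mset (\<lambda>_. 0) (mset_set (B - set_mset x))"
      using that by (intro image_mset_cong) (auto simp: not_in_iff)
    ultimately show ?thesis
      using that by (simp add: shape_def card_Diff_subset image_mset_const_eq)
  qed
  have "image_mset (count m) (mset_set ?A) = image_mset (count m') (mset_set ?A)"
    using *[of m ?A] *[of m' ?A] assms by simp
  then obtain p where p: "p permutes ?A" "\<forall>x\<in>?A. count m x = count m' (p x)"
    by (rule image_mset_eq_implies_permutes[rotated]) auto
  have cnt: "count m x = count m' (p x)" for x
  proof (cases "x \<in> ?A")
    case False
    then have "p x = x" using p(1) by (simp add: permutes_not_in)
    then show ?thesis using False by (simp add: not_in_iff)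
  qed (use p in auto)
  have "bij p" using p(1) by (rule permutes_bij)
  have "image_mset p m = m'"
  proof (rule multiset_eqI)
    fix y
    obtain x where "y = p x" using \<open>bij p\<close> by (metis bij_pointE)
    then show "count (image_mset p m) y = count m' y"
      using cnt \<open>bij p\<close> by (simp add: count_image_mset_inj bij_is_inj)
  qed
  then show thesis using that \<open>bij p\<close> by blast
qed

lemma Sym_shape_cong:
  assumes "f \<in> carrier Sym" "shape m = shape m'"
  shows "f m = f m'"
  using same_shape_imp_permuted[OF assms(2)] assms(1) ps_symmetricD[of f] by (metis Sym_simps(1))

section \<open>Triangularity of power sum products\<close>

lemma p_fun_in_Sym: "p_fun k \<in> carrier Sym"
proof -
  have "(\<exists>i. image_mset \<sigma> m = replicate_mset k i) \<longleftrightarrow> (\<exists>i. m = replicate_mset k i)" if "bij \<sigma>" for \<sigma> m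
  proof
    assume "\<exists>i. image_mset \<sigma> m = replicate_mset k i"
    then obtain i where i: "image_mset \<sigma> m = replicate_mset k i" by blast
    have "m = image_mset (Hilbert_Choice.inv \<sigma>) (image_mset \<sigma> m)"
      using that by (simp add: multiset.map_comp comp_def bij_is_inj)
    then show "\<exists>i. m = replicate_mset k i" using i by auto
  qed auto
  moreover have "ps_bounded_degree (p_fun k)"
    by (auto simp: ps_bounded_degree_def p_fun_def intro!: exI[of _ k])
  ultimately show ?thesis
    by (auto simp: p_fun_def ps_symmetric_def)
qed

lemma p_mset_in_Sym: "p_mset M \<in> carrier Sym"
  by (induction M) (use one_in_Sym mult_in_Sym[OF p_fun_in_Sym] in simp_all)

text \<open>Excludes cancellation, so that a single positive summand makes a coefficient
  positive.\<close>

lemma p_mset_nonneg: "p_mset M m \<ge> 0"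
  by (induction M arbitrary: m) (auto simp: ps_mult_def p_fun_def intro!: sum_nonneg)

text \<open>Triangularity: a monomial of \<open>p\<^sub>M\<close> has exponents obtained by merging parts of \<open>M\<close>.\<close>

lemma p_mset_nonzeroD:
  assumes "p_mset M m \<noteq> 0" "0 \<notin># M"
  shows "size m = sum_mset M \<and> card (set_mset m) \<le> size M \<and>
    (card (set_mset m) = size M \<longrightarrow> shape m = M)"
  using assms
proof (induction M arbitrary: m)
  case (add k M)
  then obtain a where a: "a \<subseteq># m" "p_fun k a \<noteq> 0" "p_mset M (m - a) \<noteq> 0"
    by (auto elim: ps_mult_nonzeroD)
  then obtain i where i: "a = replicate_mset k i"
    by (auto simp: p_fun_def split: if_splits)
  define b where "b = m - a"
  have m: "m = replicate_mset k i + b" using a i b_def by simp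
  have IH: "size b = sum_mset M" "card (set_mset b) \<le> size M"
      "card (set_mset b) = size M \<Longrightarrow> shape b = M"
    using add.IH[of b] a add.prems b_def by auto
  have set: "set_mset m = insert i (set_mset b)" using m add.prems by auto
  have "shape m = add_mset k M" if "card (set_mset m) = Suc (size M)"
  proof -
    \<comment> \<open>If i already occurred in b, then m would have no more variables than b, hence
      at most \<open>size M\<close>.\<close>
    have "i \<notin># b" using that IH(2) set by (auto simp: insert_absorb)
    then have "card (set_mset b) = size M" using that set by simp
    then show ?thesis using m shape_add_replicate[OF \<open>i \<notin># b\<close>, of k] IH(3) add.prems by simp
  qed
  then show ?case using IH m set by (simp add: card_insert_if)
qed (simp split: if_splits)

text \<open>The diagonal entries of the triangular system. A part k of the shape is the full
  exponent of some variable; splitting off that power leaves a monomial whose shape lacks this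
  part.\<close>

lemma p_mset_shape_pos: "p_mset (shape m) m > 0"
proof -
  have "shape m = M \<Longrightarrow> p_mset M m > 0" for M
  proof (induction M arbitrary: m)
    case empty
    then have "m = {#}" using size_shape[of m] by simp
    then show ?case by simp
  next
    case (add k M)
    then have "k \<in># shape m" by simp
    then obtain i where i: "i \<in># m" "count m i = k" by (auto simp: shape_def)
    let ?a = "replicate_mset k i"
    have sub: "?a \<subseteq># m" using i count_le_replicate_mset_subset_eq[of k m i] by simp
    have "i \<notin># m - ?a" using i by (simp add: in_diff_count)
    moreover have "k > 0" using i by auto
    moreover have "m = ?a + (m - ?a)" using sub by simp
    ultimately have "shape m = add_mset k (shape (m - ?a))" using shape_add_replicate by metis
    then have "p_mset M (m - ?a) > 0" using add by simp
    moreover have "p_fun k ?a = 1" by (auto simp: p_fun_def)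
    ultimately have "p_fun k ?a * p_mset M (m - ?a) > 0" by simp
    then have "(\<Sum>a | a \<subseteq># m. p_fun k a * p_mset M (m - a)) > 0"
      by (intro sum_pos2[of _ ?a]) (use sub p_mset_nonneg in \<open>auto simp: p_fun_def\<close>)
    then show ?case by (simp add: ps_mult_def)
  qed
  then show ?thesis by blast
qed

section \<open>Spanning by the complete homogeneous functions\<close>

text \<open>Positivity bounds the number of parts by their sum, just as it bounds each part.\<close>

lemma finite_bounded_pos_msets: "finite {M. 0 \<notin># M \<and> sum_mset M \<le> (d :: nat)}"
proof (rule finite_subset)
  show "{M. 0 \<notin># M \<and> sum_mset M \<le> d} \<subseteq> mset ` {xs. set xs \<subseteq> {..d} \<and> length xs \<le> d}"
  proof
    fix M assume "M \<in> {M. 0 \<notin># M \<and> sum_mset M \<le> d}"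
    then have M: "0 \<notin># M" "sum_mset M \<le> d" by auto
    have "size M \<le> sum_mset M" using M(1) by (induction M) auto
    moreover have "x \<le> sum_mset M" if "x \<in># M" for x
      using that by (auto dest!: multi_member_split)
    moreover obtain xs where "M = mset xs" by (metis ex_mset)
    ultimately show "M \<in> mset ` {xs. set xs \<subseteq> {..d} \<and> length xs \<le> d}"
      using M by (auto intro!: imageI) (meson le_trans)
  qed
qed (simp add: finite_lists_length_le)

text \<open>Elimination by the number of variables: a combination of the \<open>p_mset M\<close>
  with exactly l parts cancels all monomials of f in l variables, and by triangularity it introduces
  none in more.\<close>

lemma Sym_subset_h_span:
  assumes "f \<in> carrier Sym"
  shows "f \<in> fspace.span (h_mset ` pos_msets)"
proof -
  obtain d where d: "\<And>m. f m \<noteq> 0 \<Longrightarrow> size m \<le> d"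
    using assms by (auto simp: ps_bounded_degree_def)
  \<comment> \<open>The bound on the number of variables is strict, so that l = 0 forces f =
    0.\<close>
  have "\<lbrakk>f \<in> carrier Sym; \<And>m. f m \<noteq> 0 \<Longrightarrow> size m \<le> d \<and> card (set_mset m) < l\<rbrakk> \<Longrightarrow>
    f \<in> fspace.span (h_mset ` pos_msets)" for l f
  proof (induction l arbitrary: f)
    case 0
    then have "f = 0" by (auto simp: fun_eq_iff)
    then show ?case by (simp only: fspace.span_zero)
  next
    case (Suc l)
    define Q where "Q = {M. 0 \<notin># M \<and> sum_mset M \<le> d \<and> size M = l}"
    have finQ: "finite Q"
      by (rule finite_subset[OF _ finite_bounded_pos_msets[of d]]) (auto simp: Q_def)
    obtain rep where rep: "\<And>M. 0 \<notin># M \<Longrightarrow> shape (rep M) = M"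
      using shape_surj by metis
    \<comment> \<open>The coefficients make s agree with f on the representatives: at a monomial of
      shape M with l variables, M is the only index in Q that contributes. The denominators are
      positive by \<open>p_mset_shape_pos\<close>.\<close>
    define s where "s = (\<Sum>M\<in>Q. fscale (f (rep M) / p_mset M (rep M)) (p_mset M))"
    have s_span: "s \<in> fspace.span (h_mset ` pos_msets)"
      unfolding s_def by (intro fspace.span_sum fspace.span_scale p_mset_in_h_span) (simp add: Q_def)
    have s_Sym: "s \<in> carrier Sym"
      unfolding s_def by (intro fspace.subspace_sum[OF subspace_Sym] fspace.subspace_scale[OF subspace_Sym] p_mset_in_Sym)
    have s_apply: "s m = (\<Sum>M\<in>Q. f (rep M) / p_mset M (rep M) * p_mset M m)" for m
      by (simp add: s_def sum_fun_apply)
    have "f - s \<in> fspace.span (h_mset ` pos_msets)"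
    proof (rule Suc.IH)
      show "f - s \<in> carrier Sym"
        using fspace.subspace_diff[OF subspace_Sym] Suc.prems(1) s_Sym by blast
      fix m assume nz: "(f - s) m \<noteq> 0"
      have le: "size m \<le> d \<and> card (set_mset m) \<le> l"
      proof (cases "f m = 0")
        case True
        then have "s m \<noteq> 0" using nz by simp
        then obtain M where "M \<in> Q" "p_mset M m \<noteq> 0"
          unfolding s_apply by (metis (no_types, lifting) mult_zero_right sum.neutral)
        then show ?thesis using p_mset_nonzeroD[of M m] by (auto simp: Q_def)
      qed (use Suc.prems(2)[of m] in auto)
      moreover have "card (set_mset m) \<noteq> l"
      proof
        assume l: "card (set_mset m) = l"
        let ?M = "shape m"
        have M: "?M \<in> Q" using le l by (simp add: Q_def size_shape sum_shape shape_pos)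
        have rep_M: "shape (rep ?M) = ?M" by (simp add: rep shape_pos)
        \<comment> \<open>With as many variables as parts no parts can have been merged, so a
          nonzero coefficient would force M to be the shape of m.\<close>
        have "p_mset M m = 0" if "M \<in> Q - {?M}" for M
          using that p_mset_nonzeroD[of M m] l by (auto simp: Q_def)
        then have "s m = f (rep ?M) / p_mset ?M (rep ?M) * p_mset ?M m"
          unfolding s_apply using M finQ by (subst sum.remove[of _ ?M]) auto
        also have "\<dots> = f m"
          using Sym_shape_cong[OF Suc.prems(1) rep_M] Sym_shape_cong[OF p_mset_in_Sym[of ?M] rep_M]
            p_mset_shape_pos[of m] by simp
        finally show False using nz by simp
      qed
      ultimately show "size m \<le> d \<and> card (set_mset m) < l" by simp
    qed
    then have "(f - s) + s \<in> fspace.span (h_mset ` pos_msets)"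
      using s_span by (rule fspace.span_add)
    then show ?case by (simp only: diff_add_cancel)
  qed
  \<comment> \<open>A monomial of degree at most d has at most d variables.\<close>
  note this[of f "Suc d"]
  moreover have "card (set_mset m) \<le> size m" for m :: "nat multiset"
    by (metis mset_set_set_mset_msubset size_mset_mono size_mset_set)
  ultimately show ?thesis using assms d by (meson le_imp_less_Suc le_trans)
qed

text \<open>In degree at most \<open>d\<close> there are as many \<open>h\<^sub>M\<close> as there are independent monomial symmetric
  functions, and the former span the latter.\<close>

lemma h_mset_independent:
  assumes "finite F" "F \<subseteq> pos_msets" "(\<Sum>M\<in>F. fscale (c M) (h_mset M)) = 0" "M0 \<in> F"
  shows "c M0 = 0"
proof (rule ccontr)
  assume nz: "c M0 \<noteq> 0"
  define d where "d = Max (sum_mset ` F)"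
  define P where "P = {M. 0 \<notin># M \<and> sum_mset M \<le> d}"
  \<comment> \<open>The monomial symmetric functions.\<close>
  define mono where "mono M = (\<lambda>m. if shape m = M then 1 else 0 :: rat)" for M
  have finP: "finite P" unfolding P_def by (rule finite_bounded_pos_msets)
  have "F \<subseteq> P" using assms(1,2) by (auto simp: P_def d_def)
  then have M0: "M0 \<in> P" using assms(4) by auto
  obtain rep where rep: "\<And>M. 0 \<notin># M \<Longrightarrow> shape (rep M) = M"
    using shape_surj by metis
  have inj: "inj_on mono P"
  proof (rule inj_onI)
    fix M N assume "M \<in> P" "N \<in> P" and eq: "mono M = mono N"
    then have "shape (rep M) = M" by (auto simp: P_def rep)
    then show "M = N" using fun_cong[OF eq, of "rep M"] by (simp add: mono_def split: if_splits)
  qed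
  have indep: "fspace.independent (mono ` P)"
  proof (rule fspace.independent_if_scalars_zero)
    fix u x assume sum0: "(\<Sum>v\<in>mono ` P. fscale (u v) v) = 0" and "x \<in> mono ` P"
    then obtain M where M: "M \<in> P" "x = mono M" by blast
    \<comment> \<open>Evaluation at a monomial of shape M isolates the coefficient of
      \<open>mono M\<close>.\<close>
    have "0 = (\<Sum>v\<in>mono ` P. fscale (u v) v) (rep M)" using sum0 by simp
    also have "\<dots> = (\<Sum>N\<in>P. u (mono N) * mono N (rep M))"
      by (simp add: sum_fun_apply sum.reindex[OF inj])
    also have "\<dots> = (\<Sum>N\<in>P. if N = M then u (mono M) else 0)"
      by (intro sum.cong) (use M rep in \<open>auto simp: mono_def P_def\<close>)
    finally show "u x = 0" using M finP by simp
  qed (simp add: finP)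
  have mono_Sym: "mono M \<in> carrier Sym" if "M \<in> P" for M
  proof -
    have "shape (image_mset \<sigma> m) = shape m" if "bij \<sigma>" for \<sigma> m
      using that by (rule shape_image)
    moreover have "size m \<le> d" if "mono M m \<noteq> 0" for m
      using that sum_shape[of m] \<open>M \<in> P\<close> by (auto simp: mono_def P_def split: if_splits)
    ultimately show ?thesis by (auto simp: ps_symmetric_def ps_bounded_degree_def mono_def intro: exI[of _ d])
  qed
  \<comment> \<open>Spanning alone may involve \<open>h_mset M\<close> of degree above d. Truncation
    is linear and, by homogeneity, fixes or kills each of them.\<close>
  define tr where "tr f = (\<lambda>m. if size m \<le> d then f m else 0)" for f :: power_series
  let ?H = "h_mset ` (P - {M0})"
  have "h_mset M0 \<in> fspace.span ?H"
  proof -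
    \<comment> \<open>The assumed relation, solved for \<open>h_mset M0\<close>, makes this
      generator redundant.\<close>
    have "fscale (c M0) (h_mset M0) = - (\<Sum>M\<in>F - {M0}. fscale (c M) (h_mset M))"
      using assms(1,3,4) by (simp only: sum.remove[of F M0] eq_neg_iff_add_eq_0)
    also have "\<dots> \<in> fspace.span ?H"
      using \<open>F \<subseteq> P\<close> by (intro fspace.span_neg fspace.span_sum fspace.span_scale fspace.span_base) auto
    finally have "fscale (1 / c M0) (fscale (c M0) (h_mset M0)) \<in> fspace.span ?H"
      by (rule fspace.span_scale)
    then show ?thesis using nz by simp
  qed
  then have h_span: "h_mset M \<in> fspace.span ?H" if "M \<in> P" for M
    using that by (cases "M = M0") (auto intro: fspace.span_base)
  have tr: "tr f \<in> fspace.span ?H" if "f \<in> fspace.span (h_mset ` pos_msets)" for f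
    using that
  proof (induction rule: fspace.span_induct_alt)
    case base
    have "tr 0 = 0" by (auto simp: tr_def)
    then show ?case by (simp only: fspace.span_zero)
  next
    case (step c x y)
    then obtain M where M: "0 \<notin># M" "x = h_mset M" by auto
    have "tr x \<in> fspace.span ?H"
    proof (cases "M \<in> P")
      case True
      then have "tr x = h_mset M"
        using M h_mset_homogeneous[of M] by (force simp: tr_def P_def)
      then show ?thesis using h_span True by simp
    next
      case False
      then have "tr x = 0"
        using M h_mset_homogeneous[of M] by (force simp: tr_def P_def)
      then show ?thesis using fspace.span_zero by simp
    qed
    moreover have "tr (fscale c x + y) = fscale c (tr x) + tr y"
      by (auto simp: tr_def)
    ultimately show ?case using step by (simp only: fspace.span_add fspace.span_scale)
  qed
  have "mono ` P \<subseteq> fspace.span ?H"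
  proof
    fix x assume "x \<in> mono ` P"
    then obtain M where M: "M \<in> P" "x = mono M" by blast
    then have "tr x = x"
      using sum_shape by (fastforce simp: tr_def mono_def P_def)
    then show "x \<in> fspace.span ?H"
      using tr[OF Sym_subset_h_span[OF mono_Sym[OF M(1)]]] M by simp
  qed
  \<comment> \<open>As many independent functions as P has elements would lie in the span of fewer
    generators.\<close>
  then have "card (mono ` P) \<le> card ?H"
    by (intro conjunct2[OF fspace.independent_span_bound[OF _ indep]]) (simp add: finP)
  also have "\<dots> \<le> card (P - {M0})" using finP by (simp add: card_image_le)
  also have "\<dots> < card P" using finP M0 by (rule card_Diff1_less)
  finally show False using inj by (simp add: card_image)
qed

section \<open>The shuffle algebra of the block sizes\<close>

text \<open>The relabelling maps the underlying set onto a set of the same finite cardinality, so it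
  is injective and preserves distinctness and sizes of blocks.\<close>

lemma Bk_shift:
  assumes "finite (\<Union>\<pi>)" "finite S" "card S = sp_size \<pi>"
  shows "Bk (shift S \<pi>) = Bk \<pi>"
proof -
  define f where "f = (\<lambda>i. sorted_list_of_set S ! card {k \<in> \<Union>\<pi>. k < i})"
  have shift: "shift S \<pi> = (\<lambda>B. f ` B) ` \<pi>"
    by (simp add: shift_def f_def)
  have "f ` \<Union>\<pi> = S"
    using Union_shift[OF assms] shift by auto
  then have inj: "inj_on f (\<Union>\<pi>)"
    using assms by (intro eq_card_imp_inj_on) (auto simp: sp_size_def)
  then have "inj_on (\<lambda>B. f ` B) \<pi>"
    by (intro inj_onI) (metis Union_upper inj_on_image_eq_iff)
  moreover have "card (f ` B) = card B" if "B \<in> \<pi>" for B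
    using inj that by (meson Union_upper card_image inj_on_subset)
  moreover have "finite \<pi>"
    using assms(1) by (rule finite_UnionD)
  ultimately show ?thesis
    by (auto simp: Bk_def shift multiset.map_comp simp flip: image_mset_mset_set intro!: image_mset_cong)
qed

lemma set_partitionsD:
  assumes "\<pi> \<in> \<Psi>"
  shows "finite (\<Union>\<pi>)" "finite \<pi>" "{} \<notin> \<pi>" "disjoint \<pi>" "\<And>B. B \<in> \<pi> \<Longrightarrow> finite B"
proof -
  show fin: "finite (\<Union>\<pi>)" using assms by (rule finite_Union_set_partitions)
  then show "finite \<pi>" by (rule finite_UnionD)
  show "finite B" if "B \<in> \<pi>" for B using fin that by (meson Union_upper finite_subset)
qed (use assms in \<open>auto simp: set_partitions_def partition_on_def\<close>)

lemma sum_mset_Bk: "\<pi> \<in> \<Psi> \<Longrightarrow> sum_mset (Bk \<pi>) = sp_size \<pi>"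
  using set_partitionsD[of \<pi>]
  by (simp add: Bk_def sp_size_def card_Union_disjoint sum_unfold_sum_mset)

lemma Bk_pos: "\<pi> \<in> \<Psi> \<Longrightarrow> 0 \<notin># Bk \<pi>"
  using set_partitionsD[of \<pi>] by (auto simp: Bk_def)

text \<open>For every choice of S the two relabelled partitions live on complementary sets, so their
  block sizes simply combine; the binomial coefficient counts the choices.\<close>

lemma Bk_ASh:
  assumes "\<tau> \<in> \<Psi>" "\<theta> \<in> \<Psi>" "disjoint_partitions \<tau> \<theta>"
  shows "image_mset Bk (ASh \<tau> \<theta>) =
    replicate_mset ((sp_size \<tau> + sp_size \<theta>) choose sp_size \<tau>) (Bk \<tau> + Bk \<theta>)"
proof -
  let ?U = "\<Union>\<tau> \<union> \<Union>\<theta>"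
  note \<tau> = set_partitionsD[OF assms(1)] and \<theta> = set_partitionsD[OF assms(2)]
  have U: "finite ?U" "card ?U = sp_size \<tau> + sp_size \<theta>"
    using \<tau> \<theta> assms(3) by (simp_all add: card_Un_disjoint disjoint_partitions_def sp_size_def)
  have "Bk (shift S \<tau> \<union> shift (?U - S) \<theta>) = Bk \<tau> + Bk \<theta>" if "S \<subseteq> ?U" "card S = sp_size \<tau>" for S
  proof -
    have S: "finite S" "card (?U - S) = sp_size \<theta>"
      using that U by (auto simp: card_Diff_subset finite_subset)
    have Un: "\<Union>(shift S \<tau>) = S" "\<Union>(shift (?U - S) \<theta>) = ?U - S"
      using Union_shift that S \<tau>(1) \<theta>(1) U(1) by simp_all
    \<comment> \<open>An empty block could belong to both partitions and would then be counted only
      once in the union.\<close>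
    have ne: "{} \<notin> shift S \<tau>"
      using \<tau>(3) by (auto simp: shift_def)
    have "shift S \<tau> \<inter> shift (?U - S) \<theta> = {}"
    proof (rule equals0I, elim IntE)
      fix B assume "B \<in> shift S \<tau>" "B \<in> shift (?U - S) \<theta>"
      then have "B \<subseteq> S" "B \<subseteq> ?U - S" "B \<noteq> {}"
        using Un ne by (metis Union_upper)+
      then show False by blast
    qed
    moreover have "finite (shift S \<tau>)" "finite (shift (?U - S) \<theta>)"
      using \<tau>(2) \<theta>(2) by (simp_all add: shift_def)
    ultimately have "Bk (shift S \<tau> \<union> shift (?U - S) \<theta>) = Bk (shift S \<tau>) + Bk (shift (?U - S) \<theta>)"
      by (simp add: Bk_def mset_set_Union)
    then show ?thesis
      using Bk_shift that S \<tau>(1) \<theta>(1) U(1) by simp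
  qed
  then have "image_mset Bk (ASh \<tau> \<theta>) =
      {# Bk \<tau> + Bk \<theta>. S \<in># mset_set {S. S \<subseteq> ?U \<and> card S = sp_size \<tau>} #}"
    unfolding ASh_def multiset.map_comp comp_def
    using U(1) by (intro image_mset_cong) auto
  then show ?thesis
    using n_subsets[OF U(1)] U(2) by (simp add: image_mset_const_eq)
qed

lemma shuffle_compatible_Bk: "shuffle_compatible Bk"
  unfolding shuffle_compatible_def
proof (intro conjI ballI impI)
  fix \<tau> \<theta> assume "\<tau> \<in> \<Psi>" "\<theta> \<in> \<Psi>" "std \<tau> = std \<theta>"
  moreover have "Bk (std \<pi>) = Bk \<pi>" if "\<pi> \<in> \<Psi>" for \<pi>
    unfolding std_def using set_partitionsD(1)[OF that] by (intro Bk_shift) auto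
  ultimately show "Bk \<tau> = Bk \<theta>" by metis
qed (simp add: Bk_ASh)

section \<open>Partitions with prescribed block sizes\<close>

lemma finite_nat_bounded_le:
  fixes A :: "nat set"
  assumes "finite A"
  obtains K where "A \<subseteq> {..K}"
proof -
  obtain K where "\<forall>x\<in>A. x \<le> K"
    using assms finite_nat_set_iff_bounded_le by blast
  then show thesis using that[of K] by blast
qed

text \<open>Built from consecutive intervals, each beyond all earlier blocks. The bound N allows
  representatives to be placed apart from a given partition.\<close>

lemma set_partition_with_Bk:
  assumes "0 \<notin># M"
  obtains \<pi> where "\<pi> \<in> \<Psi>" "Bk \<pi> = M" "\<Union>\<pi> \<subseteq> {N<..}"
proof -
  have "\<exists>\<pi>\<in>\<Psi>. Bk \<pi> = M \<and> \<Union>\<pi> \<subseteq> {N<..}"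
    using assms
  proof (induction M)
    case empty
    have "{} \<in> \<Psi>" by (auto simp: set_partitions_def partition_on_def)
    then show ?case by (intro bexI[of _ "{}"]) (simp_all add: Bk_def)
  next
    case (add n M)
    then obtain \<pi> where \<pi>: "\<pi> \<in> \<Psi>" "Bk \<pi> = M" "\<Union>\<pi> \<subseteq> {N<..}" by auto
    obtain K where K: "\<Union>\<pi> \<subseteq> {..K}"
      using finite_nat_bounded_le[OF set_partitionsD(1)[OF \<pi>(1)]] .
    define L where "L = max K N"
    define B where "B = {L<..L + n}"
    have disj: "B \<inter> \<Union>\<pi> = {}" using K by (fastforce simp: B_def L_def)
    have "card B = n" "B \<noteq> {}" using add.prems by (auto simp: B_def)
    have new: "B \<notin> \<pi>" using disj \<open>B \<noteq> {}\<close> by blast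
    have "disjoint (insert B \<pi>)"
      using set_partitionsD(4)[OF \<pi>(1)] disj by (auto simp: pairwise_insert disjnt_def)
    moreover have "finite B" "B \<subseteq> {N<..}" by (auto simp: B_def L_def)
    moreover have "\<Union>\<pi> \<subseteq> {1..}"
      using \<pi>(1) by (auto simp: set_partitions_def partition_on_def)
    ultimately have "finite (\<Union>(insert B \<pi>)) \<and> \<Union>(insert B \<pi>) \<subseteq> {1..}
        \<and> partition_on (\<Union>(insert B \<pi>)) (insert B \<pi>)"
      using set_partitionsD(1,3)[OF \<pi>(1)] \<open>B \<noteq> {}\<close> by (auto simp: partition_on_def B_def)
    then have "insert B \<pi> \<in> \<Psi>"
      unfolding set_partitions_def by blast
    moreover have "Bk (insert B \<pi>) = add_mset n M"
      using new \<open>card B = n\<close> set_partitionsD(2)[OF \<pi>(1)] \<pi>(2) by (simp add: Bk_def)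
    ultimately show ?case using \<pi>(3) \<open>B \<subseteq> {N<..}\<close> by blast
  qed
  then show thesis using that by blast
qed

section \<open>Classes and vectors indexed by integer partitions\<close>

text \<open>A class of \<open>st_class Bk\<close> without its size condition, which is implied
  because the block sizes add up to the size.\<close>

definition Bk_class :: "nat multiset \<Rightarrow> nat set set set"
  where "Bk_class M = {\<tau>\<in>\<Psi>. Bk \<tau> = M}"

definition Bk_vec :: "nat multiset \<Rightarrow> class_vec"
  where "Bk_vec M = (\<lambda>E. if E = Bk_class M then 1 else 0)"

lemma inj_Bk_class: "inj_on Bk_class pos_msets"
proof (rule inj_onI)
  fix M N assume "M \<in> pos_msets" "N \<in> pos_msets" "Bk_class M = Bk_class N"
  moreover from this(1) obtain \<pi> where "\<pi> \<in> \<Psi>" "Bk \<pi> = M"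
    using set_partition_with_Bk[of M 0] by auto
  ultimately show "M = N" by (auto simp: Bk_class_def)
qed

text \<open>The size equation stands in for membership in \<Psi>, so that the lemma applies to
  members of an arc-shuffle, whose sizes come from \<open>sp_size_ASh\<close>.\<close>

lemma st_class_Bk:
  assumes "sp_size \<pi> = sum_mset (Bk \<pi>)"
  shows "st_class Bk \<pi> = Bk_class (Bk \<pi>)"
proof -
  have "sp_size \<tau> = sp_size \<pi>" if "\<tau> \<in> \<Psi>" "Bk \<tau> = Bk \<pi>" for \<tau>
    using sum_mset_Bk[OF that(1)] that(2) assms by simp
  then show ?thesis
    unfolding st_class_def Bk_class_def by (intro Collect_cong) auto
qed

lemma basis_vec_Bk:
  assumes "sp_size \<pi> = sum_mset (Bk \<pi>)"
  shows "basis_vec Bk \<pi> = Bk_vec (Bk \<pi>)"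
  by (simp add: basis_vec_def Bk_vec_def st_class_Bk[OF assms])

lemma st_class_image: "st_class Bk ` \<Psi> = Bk_class ` pos_msets"
proof safe
  fix \<pi> assume "\<pi> \<in> \<Psi>"
  then show "st_class Bk \<pi> \<in> Bk_class ` pos_msets"
    by (simp add: st_class_Bk sum_mset_Bk Bk_pos)
next
  fix M :: "nat multiset" assume "0 \<notin># M"
  then obtain \<pi> where "\<pi> \<in> \<Psi>" "Bk \<pi> = M"
    using set_partition_with_Bk[of M 0] by auto
  then show "Bk_class M \<in> st_class Bk ` \<Psi>"
    by (metis image_eqI st_class_Bk sum_mset_Bk)
qed

abbreviation Bk_algebra :: "(rat, class_vec) module"
  where "Bk_algebra \<equiv> shuffle_algebra Bk"

lemma Bk_algebra_simps [simp]:
  "f \<oplus>\<^bsub>Bk_algebra\<^esub> g = f + g" "\<zero>\<^bsub>Bk_algebra\<^esub> = 0" "c \<odot>\<^bsub>Bk_algebra\<^esub> f = fscale c f"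
  "\<one>\<^bsub>Bk_algebra\<^esub> = Bk_vec {#}"
proof -
  show "\<one>\<^bsub>Bk_algebra\<^esub> = Bk_vec {#}"
    using basis_vec_Bk[of "{}"] by (simp add: shuffle_algebra_def Bk_def sp_size_def)
qed (auto simp: shuffle_algebra_def fun_eq_iff)

lemma Bk_algebra_carrier_iff:
  "f \<in> carrier Bk_algebra \<longleftrightarrow> finite {C. f C \<noteq> 0} \<and> {C. f C \<noteq> 0} \<subseteq> Bk_class ` pos_msets"
  by (simp add: shuffle_algebra_def st_class_image)

definition coord_supp :: "class_vec \<Rightarrow> nat multiset set"
  where "coord_supp f = {M. 0 \<notin># M \<and> f (Bk_class M) \<noteq> 0}"

lemma coord_supp_pos: "coord_supp f \<subseteq> pos_msets"
  by (auto simp: coord_supp_def)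

lemma Bk_algebra_carrierD:
  assumes "f \<in> carrier Bk_algebra"
  shows "{C. f C \<noteq> 0} = Bk_class ` coord_supp f" "finite (coord_supp f)"
proof -
  have f: "finite {C. f C \<noteq> 0}" "{C. f C \<noteq> 0} \<subseteq> Bk_class ` pos_msets"
    using assms by (simp_all add: Bk_algebra_carrier_iff)
  then show supp: "{C. f C \<noteq> 0} = Bk_class ` coord_supp f"
    by (auto simp: coord_supp_def)
  show "finite (coord_supp f)"
    using f(1) inj_on_subset[OF inj_Bk_class coord_supp_pos[of f]] unfolding supp
    by (simp add: finite_image_iff)
qed

lemma Bk_vec_in_carrier: "0 \<notin># M \<Longrightarrow> Bk_vec M \<in> carrier Bk_algebra"
  by (auto simp: Bk_algebra_carrier_iff Bk_vec_def)

lemma subspace_Bk_algebra: "fspace.subspace (carrier Bk_algebra)"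
  unfolding fspace.subspace_def
proof (intro conjI ballI allI)
  fix f g assume fg: "f \<in> carrier Bk_algebra" "g \<in> carrier Bk_algebra"
  have "{C. (f + g) C \<noteq> 0} \<subseteq> {C. f C \<noteq> 0} \<union> {C. g C \<noteq> 0}" by auto
  from finite_subset[OF this] order_trans[OF this] show "f + g \<in> carrier Bk_algebra"
    using fg by (simp add: Bk_algebra_carrier_iff del: plus_fun_apply)
next
  fix c f assume f: "f \<in> carrier Bk_algebra"
  have "{C. fscale c f C \<noteq> 0} \<subseteq> {C. f C \<noteq> 0}" by auto
  from finite_subset[OF this] order_trans[OF this] show "fscale c f \<in> carrier Bk_algebra"
    using f by (simp add: Bk_algebra_carrier_iff del: fscale_apply)
qed (simp add: Bk_algebra_carrier_iff)

lemma Bk_algebra_expansion: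
  assumes "f \<in> carrier Bk_algebra"
  shows "f = (\<Sum>M\<in>coord_supp f. fscale (f (Bk_class M)) (Bk_vec M))"
proof
  fix E
  have "(\<Sum>M\<in>coord_supp f. fscale (f (Bk_class M)) (Bk_vec M)) E =
    (\<Sum>M\<in>coord_supp f. if E = Bk_class M then f E else 0)"
    unfolding sum_fun_apply by (intro sum.cong) (auto simp: Bk_vec_def)
  also have "\<dots> = (\<Sum>C | f C \<noteq> 0. if E = C then f E else 0)"
    using inj_on_subset[OF inj_Bk_class coord_supp_pos[of f]]
    by (simp add: Bk_algebra_carrierD(1)[OF assms] sum.reindex)
  also have "\<dots> = f E"
  proof -
    have "finite {C. f C \<noteq> 0}"
      using Bk_algebra_carrierD(2)[OF assms] unfolding Bk_algebra_carrierD(1)[OF assms] by simp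
    then show ?thesis by simp
  qed
  finally show "f E = (\<Sum>M\<in>coord_supp f. fscale (f (Bk_class M)) (Bk_vec M)) E" ..
qed

section \<open>Structure constants of the shuffle algebra\<close>

lemma class_mult_Bk:
  assumes "0 \<notin># M" "0 \<notin># N"
  shows "class_mult Bk (Bk_class M) (Bk_class N) =
    fscale (of_nat ((sum_mset M + sum_mset N) choose sum_mset M)) (Bk_vec (M + N))"
proof -
  obtain \<tau> where \<tau>: "\<tau> \<in> \<Psi>" "Bk \<tau> = M"
    using set_partition_with_Bk[OF assms(1), of 0] .
  obtain K where K: "\<Union>\<tau> \<subseteq> {..K}"
    using finite_nat_bounded_le[OF set_partitionsD(1)[OF \<tau>(1)]] .
  \<comment> \<open>Placing \<theta> beyond the elements of \<tau> makes the two representatives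
    disjoint.\<close>
  obtain \<theta> where \<theta>: "\<theta> \<in> \<Psi>" "Bk \<theta> = N" "\<Union>\<theta> \<subseteq> {K<..}"
    using set_partition_with_Bk[OF assms(2), of K] .
  have disj: "disjoint_partitions \<tau> \<theta>"
    using K \<theta>(3) by (fastforce simp: disjoint_partitions_def)
  have size: "sp_size \<tau> = sum_mset M" "sp_size \<theta> = sum_mset N"
    using sum_mset_Bk \<tau> \<theta> by metis+
  let ?n = "(sum_mset M + sum_mset N) choose sum_mset M"
  have ash: "image_mset Bk (ASh \<tau> \<theta>) = replicate_mset ?n (M + N)"
    using Bk_ASh[OF \<tau>(1) \<theta>(1) disj] \<tau> \<theta> size by simp
  have "basis_vec Bk \<pi> = Bk_vec (M + N)" if "\<pi> \<in># ASh \<tau> \<theta>" for \<pi>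
  proof -
    have "Bk \<pi> \<in># image_mset Bk (ASh \<tau> \<theta>)" using that by simp
    then have "Bk \<pi> = M + N" unfolding ash by (simp split: if_splits)
    then show ?thesis
      using basis_vec_Bk[of \<pi>] sp_size_ASh[OF \<tau>(1) \<theta>(1) disj that] size by simp
  qed
  then have "(\<Sum>\<pi>\<in>#ASh \<tau> \<theta>. basis_vec Bk \<pi> E) = of_nat (size (ASh \<tau> \<theta>)) * Bk_vec (M + N) E" for E
    by (simp cong: image_mset_cong)
  moreover have "size (ASh \<tau> \<theta>) = ?n"
    using arg_cong[OF ash, of size] by simp
  \<comment> \<open>Passing through the product of basis vectors lets \<open>basis_vec_mult\<close>
    replace the chosen representatives in \<open>class_mult\<close> by \<tau> and \<theta>.\<close>
  moreover have "basis_vec Bk \<tau> \<otimes>\<^bsub>Bk_algebra\<^esub> basis_vec Bk \<theta> =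
      class_mult Bk (Bk_class M) (Bk_class N)"
  proof -
    have supp: "{C. Bk_vec L C \<noteq> 0} = {Bk_class L}" for L by (auto simp: Bk_vec_def)
    show ?thesis
      using \<tau> \<theta> size basis_vec_Bk[of \<tau>] basis_vec_Bk[of \<theta>]
      by (simp add: shuffle_algebra_def supp) (simp add: Bk_vec_def)
  qed
  ultimately show ?thesis
    using basis_vec_mult[OF shuffle_compatible_Bk \<tau>(1) \<theta>(1) disj] by (simp add: fun_eq_iff)
qed

lemma Bk_algebra_mult:
  assumes "f \<in> carrier Bk_algebra" "g \<in> carrier Bk_algebra"
  shows "f \<otimes>\<^bsub>Bk_algebra\<^esub> g = (\<Sum>(M, N)\<in>coord_supp f \<times> coord_supp g.
    fscale (f (Bk_class M) * g (Bk_class N) * of_nat ((sum_mset M + sum_mset N) choose sum_mset M))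
      (Bk_vec (M + N)))"
proof
  fix E
  note inj = inj_on_subset[OF inj_Bk_class coord_supp_pos]
  have "(f \<otimes>\<^bsub>Bk_algebra\<^esub> g) E = (\<Sum>M\<in>coord_supp f. \<Sum>N\<in>coord_supp g.
      f (Bk_class M) * g (Bk_class N) * class_mult Bk (Bk_class M) (Bk_class N) E)"
    by (simp add: shuffle_algebra_def Bk_algebra_carrierD(1)[OF assms(1)]
        Bk_algebra_carrierD(1)[OF assms(2)] sum.reindex[OF inj])
  also have "\<dots> = (\<Sum>M\<in>coord_supp f. \<Sum>N\<in>coord_supp g.
      fscale (f (Bk_class M) * g (Bk_class N) * of_nat ((sum_mset M + sum_mset N) choose sum_mset M))
        (Bk_vec (M + N)) E)"
    by (intro sum.cong refl) (simp add: class_mult_Bk coord_supp_def)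
  finally show "(f \<otimes>\<^bsub>Bk_algebra\<^esub> g) E = (\<Sum>(M, N)\<in>coord_supp f \<times> coord_supp g.
      fscale (f (Bk_class M) * g (Bk_class N) * of_nat ((sum_mset M + sum_mset N) choose sum_mset M))
        (Bk_vec (M + N))) E"
    by (simp add: sum_fun_apply sum.cartesian_product case_prod_unfold)
qed

section \<open>The linear map to symmetric functions\<close>

definition scaled_h :: "nat multiset \<Rightarrow> power_series"
  where "scaled_h M = fscale (1 / fact (sum_mset M)) (h_mset M)"

text \<open>The factorials are chosen for this: they absorb the binomial coefficient, so
  \<open>scaled_h\<close> has the structure constants of \<open>class_mult_Bk\<close>.\<close>

lemma scaled_h_mult:
  "ps_mult (scaled_h M) (scaled_h N) =
    fscale (of_nat ((sum_mset M + sum_mset N) choose sum_mset M)) (scaled_h (M + N))"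
proof -
  have "(of_nat ((sum_mset M + sum_mset N) choose sum_mset M) :: rat) =
      fact (sum_mset M + sum_mset N) / (fact (sum_mset M) * fact (sum_mset N))"
    by (simp add: binomial_fact)
  then show ?thesis
    by (simp only: scaled_h_def ps_mult_scale_left ps_mult_scale_right fspace.scale_scale
        h_mset_simps sum_mset.union) simp
qed

definition Bk_map :: "class_vec \<Rightarrow> power_series"
  where "Bk_map f = (\<Sum>M\<in>coord_supp f. fscale (f (Bk_class M)) (scaled_h M))"

text \<open>Allows two vectors to be expanded over a common index set, as additivity
  requires.\<close>

lemma Bk_map_superset:
  assumes "finite F" "coord_supp f \<subseteq> F" "F \<subseteq> pos_msets"
  shows "Bk_map f = (\<Sum>M\<in>F. fscale (f (Bk_class M)) (scaled_h M))"
  unfolding Bk_map_def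
proof (rule sum.mono_neutral_left[OF assms(1,2)], rule ballI)
  fix M assume "M \<in> F - coord_supp f"
  then have "f (Bk_class M) = 0" using assms(3) by (auto simp: coord_supp_def)
  then show "fscale (f (Bk_class M)) (scaled_h M) = 0" by (simp only: fspace.scale_zero_left)
qed

lemma Bk_map_add:
  assumes "f \<in> carrier Bk_algebra" "g \<in> carrier Bk_algebra"
  shows "Bk_map (f + g) = Bk_map f + Bk_map g"
proof -
  let ?F = "coord_supp f \<union> coord_supp g"
  have F: "finite ?F" "?F \<subseteq> pos_msets" "coord_supp (f + g) \<subseteq> ?F"
    using assms by (auto simp: Bk_algebra_carrierD) (auto simp: coord_supp_def)
  show ?thesis
    using Bk_map_superset[OF F(1) F(3) F(2)] Bk_map_superset[OF F(1) _ F(2), of f]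
      Bk_map_superset[OF F(1) _ F(2), of g]
    by (simp only: Un_upper1 Un_upper2 plus_fun_apply fspace.scale_left_distrib sum.distrib)
qed

lemma Bk_map_scale:
  assumes "f \<in> carrier Bk_algebra"
  shows "Bk_map (fscale c f) = fscale c (Bk_map f)"
proof -
  have "coord_supp (fscale c f) \<subseteq> coord_supp f" by (auto simp: coord_supp_def)
  from Bk_map_superset[OF Bk_algebra_carrierD(2)[OF assms] this coord_supp_pos] show ?thesis
    by (simp only: Bk_map_def fspace.scale_sum_right fspace.scale_scale fscale_apply)
qed

lemma Bk_map_vec:
  assumes "0 \<notin># M"
  shows "Bk_map (Bk_vec M) = scaled_h M"
proof -
  have "coord_supp (Bk_vec M) = {M}"
    using assms inj_onD[OF inj_Bk_class] by (auto simp: coord_supp_def Bk_vec_def)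
  then show ?thesis by (simp add: Bk_map_def Bk_vec_def)
qed

lemma Bk_map_zero: "Bk_map 0 = 0"
  by (simp add: Bk_map_def coord_supp_def)

lemma linear_map_sum:
  assumes "linear_map \<rat>\<^sub>F Bk_algebra Sym \<phi>" "finite I" "\<And>i. i \<in> I \<Longrightarrow> v i \<in> carrier Bk_algebra"
  shows "\<phi> (\<Sum>i\<in>I. fscale (c i) (v i)) = (\<Sum>i\<in>I. fscale (c i) (\<phi> (v i)))"
proof -
  have add: "\<phi> (f + g) = \<phi> f + \<phi> g" if "f \<in> carrier Bk_algebra" "g \<in> carrier Bk_algebra" for f g
    using assms(1) that by (simp add: linear_map_def)
  have scale: "\<phi> (fscale c f) = fscale c (\<phi> f)" if "f \<in> carrier Bk_algebra" for c f
    using assms(1) that by (simp add: linear_map_def)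
  note subspace = subspace_Bk_algebra
  have zero: "\<phi> 0 = 0"
    using scale[OF fspace.subspace_0[OF subspace], of 0] by (simp only: fspace.scale_zero_left)
  show ?thesis using assms(2,3)
  proof (induction I rule: finite_induct)
    case (insert i I)
    have "(\<Sum>i\<in>I. fscale (c i) (v i)) \<in> carrier Bk_algebra"
      by (intro fspace.subspace_sum[OF subspace] fspace.subspace_scale[OF subspace] insert.prems) simp
    then have "\<phi> (fscale (c i) (v i) + (\<Sum>i\<in>I. fscale (c i) (v i))) =
        fscale (c i) (\<phi> (v i)) + \<phi> (\<Sum>i\<in>I. fscale (c i) (v i))"
      using insert.prems fspace.subspace_scale[OF subspace]
      by (simp only: add scale insertI1)
    then show ?case
      using insert by (simp only: sum.insert insert_iff simp_thms)
  qed (simp only: sum.empty zero)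
qed

lemma Bk_map_in_Sym: "Bk_map f \<in> carrier Sym"
  unfolding Bk_map_def scaled_h_def
  by (intro fspace.subspace_sum[OF subspace_Sym] fspace.subspace_scale[OF subspace_Sym] h_mset_in_Sym)

lemma linear_Bk_map: "linear_map \<rat>\<^sub>F Bk_algebra Sym Bk_map"
  unfolding linear_map_def using Bk_map_in_Sym Bk_map_add Bk_map_scale
  by (simp del: Sym_simps(1))

text \<open>A linear map is determined on the basis, so every \<phi> with the prescribed values
  inherits what holds for \<open>Bk_map\<close> on the carrier.\<close>

lemma linear_map_eq_Bk_map:
  assumes "linear_map \<rat>\<^sub>F Bk_algebra Sym \<phi>" "\<And>M. 0 \<notin># M \<Longrightarrow> \<phi> (Bk_vec M) = scaled_h M"
    and "f \<in> carrier Bk_algebra"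
  shows "\<phi> f = Bk_map f"
proof -
  have "\<phi> (\<Sum>M\<in>coord_supp f. fscale (f (Bk_class M)) (Bk_vec M)) =
      (\<Sum>M\<in>coord_supp f. fscale (f (Bk_class M)) (\<phi> (Bk_vec M)))"
    by (rule linear_map_sum[OF assms(1) Bk_algebra_carrierD(2)[OF assms(3)]])
      (simp add: coord_supp_def Bk_vec_in_carrier)
  also have "\<dots> = Bk_map f"
    unfolding Bk_map_def by (rule sum.cong) (simp_all add: assms(2) coord_supp_def)
  finally show ?thesis
    unfolding Bk_algebra_expansion[OF assms(3), symmetric] .
qed

section \<open>Bijectivity\<close>

text \<open>Independence of the \<open>h_mset M\<close>, applied to the difference of two vectors
  with equal image.\<close>

lemma Bk_map_inj: "inj_on Bk_map (carrier Bk_algebra)"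
proof (rule inj_onI)
  fix f g assume fg: "f \<in> carrier Bk_algebra" "g \<in> carrier Bk_algebra" and eq: "Bk_map f = Bk_map g"
  define d where "d = f + fscale (- 1) g"
  have d: "d \<in> carrier Bk_algebra"
    unfolding d_def by (intro fspace.subspace_add[OF subspace_Bk_algebra]
        fspace.subspace_scale[OF subspace_Bk_algebra] fg)
  have "Bk_map d = Bk_map f + fscale (- 1) (Bk_map g)"
    unfolding d_def using Bk_map_add Bk_map_scale fg fspace.subspace_scale[OF subspace_Bk_algebra] by metis
  then have "Bk_map d = 0" using eq by (auto simp: fun_eq_iff)
  then have "(\<Sum>M\<in>coord_supp d. fscale (d (Bk_class M) * (1 / fact (sum_mset M))) (h_mset M)) = 0"
    by (simp only: Bk_map_def scaled_h_def fspace.scale_scale)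
  then have "d (Bk_class M) * (1 / fact (sum_mset M)) = 0" if "M \<in> coord_supp d" for M
    by (rule h_mset_independent[OF Bk_algebra_carrierD(2)[OF d] coord_supp_pos _ that])
  then have "coord_supp d = {}" by (auto simp: coord_supp_def)
  then have "{C. d C \<noteq> 0} = {}" using Bk_algebra_carrierD(1)[OF d] by simp
  then show "f = g" by (auto simp: d_def fun_eq_iff)
qed

lemma Bk_map_image: "Bk_map ` carrier Bk_algebra = carrier Sym"
proof
  show "carrier Sym \<subseteq> Bk_map ` carrier Bk_algebra"
  proof
    fix f assume "f \<in> carrier Sym"
    then have "f \<in> fspace.span (h_mset ` pos_msets)" by (rule Sym_subset_h_span)
    then show "f \<in> Bk_map ` carrier Bk_algebra"
    proof (induction rule: fspace.span_induct_alt)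
      case base
      show ?case
        using Bk_map_zero fspace.subspace_0[OF subspace_Bk_algebra] by (metis image_eqI)
    next
      case (step c x y)
      then obtain M g where M: "0 \<notin># M" "x = h_mset M" and g: "g \<in> carrier Bk_algebra" "y = Bk_map g"
        by blast
      \<comment> \<open>The factorial undoes the scaling in \<open>scaled_h\<close>.\<close>
      let ?v = "fscale (c * fact (sum_mset M)) (Bk_vec M)"
      have v: "?v \<in> carrier Bk_algebra"
        by (rule fspace.subspace_scale[OF subspace_Bk_algebra Bk_vec_in_carrier[OF M(1)]])
      have "Bk_map ?v = fscale (c * fact (sum_mset M)) (scaled_h M)"
        by (simp only: Bk_map_scale[OF Bk_vec_in_carrier[OF M(1)]] Bk_map_vec[OF M(1)])
      also have "\<dots> = fscale c x"
        by (auto simp: scaled_h_def M(2) fun_eq_iff)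
      finally have "Bk_map (?v + g) = fscale c x + y"
        by (simp only: Bk_map_add[OF v g(1)] g(2))
      moreover have "?v + g \<in> carrier Bk_algebra"
        using v g(1) by (rule fspace.subspace_add[OF subspace_Bk_algebra])
      ultimately show ?case by (metis image_eqI)
    qed
  qed
qed (use Bk_map_in_Sym in blast)

section \<open>Multiplicativity and transport of the algebra axioms\<close>

lemma Bk_algebra_mult_closed:
  assumes "f \<in> carrier Bk_algebra" "g \<in> carrier Bk_algebra"
  shows "f \<otimes>\<^bsub>Bk_algebra\<^esub> g \<in> carrier Bk_algebra"
  unfolding Bk_algebra_mult[OF assms] case_prod_unfold
  by (intro fspace.subspace_sum[OF subspace_Bk_algebra] fspace.subspace_scale[OF subspace_Bk_algebra]
      Bk_vec_in_carrier) (auto simp: coord_supp_def)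

lemma Bk_map_mult:
  assumes "f \<in> carrier Bk_algebra" "g \<in> carrier Bk_algebra"
  shows "Bk_map (f \<otimes>\<^bsub>Bk_algebra\<^esub> g) = ps_mult (Bk_map f) (Bk_map g)"
proof -
  let ?I = "coord_supp f \<times> coord_supp g"
  let ?b = "\<lambda>M N. of_nat ((sum_mset M + sum_mset N) choose sum_mset M) :: rat"
  have "Bk_map (f \<otimes>\<^bsub>Bk_algebra\<^esub> g) = (\<Sum>i\<in>?I.
      fscale (f (Bk_class (fst i)) * g (Bk_class (snd i)) * ?b (fst i) (snd i)) (Bk_map (Bk_vec (fst i + snd i))))"
    unfolding Bk_algebra_mult[OF assms] case_prod_unfold
    by (rule linear_map_sum[OF linear_Bk_map finite_cartesian_product[OF
            Bk_algebra_carrierD(2)[OF assms(1)] Bk_algebra_carrierD(2)[OF assms(2)]]])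
      (auto simp: coord_supp_def intro!: Bk_vec_in_carrier)
  also have "\<dots> = (\<Sum>i\<in>?I. fscale (f (Bk_class (fst i)) * g (Bk_class (snd i)))
      (ps_mult (scaled_h (fst i)) (scaled_h (snd i))))"
  proof (rule sum.cong[OF refl])
    fix i assume "i \<in> ?I"
    then have "0 \<notin># fst i + snd i" by (auto simp: coord_supp_def)
    then show "fscale (f (Bk_class (fst i)) * g (Bk_class (snd i)) * ?b (fst i) (snd i))
        (Bk_map (Bk_vec (fst i + snd i))) = fscale (f (Bk_class (fst i)) * g (Bk_class (snd i)))
        (ps_mult (scaled_h (fst i)) (scaled_h (snd i)))"
      by (simp only: Bk_map_vec not_False_eq_True scaled_h_mult fspace.scale_scale)
  qed
  also have "\<dots> = (\<Sum>M\<in>coord_supp f. \<Sum>N\<in>coord_supp g.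
      fscale (f (Bk_class M) * g (Bk_class N)) (ps_mult (scaled_h M) (scaled_h N)))"
    by (simp only: sum.cartesian_product case_prod_unfold)
  also have "\<dots> = ps_mult (Bk_map f) (Bk_map g)"
    by (simp only: Bk_map_def ps_mult_sum_left ps_mult_sum_right ps_mult_scale_left
        ps_mult_scale_right fspace.scale_scale fspace.scale_sum_right)
      (subst sum.swap, simp only: mult.commute)
  finally show ?thesis .
qed

lemma Bk_map_one: "Bk_map (Bk_vec {#}) = ps_one"
  by (subst Bk_map_vec) (auto simp: scaled_h_def fun_eq_iff)

text \<open>Both sides of each law of the product lie in the carrier, and their images under the
  injective \<open>Bk_map\<close> agree by the same law for \<open>ps_mult\<close>.\<close>

lemma algebra_Bk_algebra: "algebra \<rat>\<^sub>F Bk_algebra"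
proof (rule algebra_subspaceI[OF subspace_Bk_algebra])
  note [simp] = Bk_map_mult Bk_algebra_mult_closed Bk_map_add Bk_map_scale
    fspace.subspace_add[OF subspace_Bk_algebra] fspace.subspace_scale[OF subspace_Bk_algebra]
  note inj = inj_onD[OF Bk_map_inj]
  fix f assume f [simp]: "f \<in> carrier Bk_algebra"
  show "\<one>\<^bsub>Bk_algebra\<^esub> \<otimes>\<^bsub>Bk_algebra\<^esub> f = f"
    by (rule inj) (simp_all add: Bk_vec_in_carrier Bk_map_one)
  fix g assume g [simp]: "g \<in> carrier Bk_algebra"
  show "f \<otimes>\<^bsub>Bk_algebra\<^esub> g = g \<otimes>\<^bsub>Bk_algebra\<^esub> f"
    by (rule inj) (simp_all add: ps_mult_commute)
  show "fscale c f \<otimes>\<^bsub>Bk_algebra\<^esub> g = fscale c (f \<otimes>\<^bsub>Bk_algebra\<^esub> g)" for c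
    by (rule inj) (simp_all add: ps_mult_scale_left)
  fix h assume h [simp]: "h \<in> carrier Bk_algebra"
  show "(f \<otimes>\<^bsub>Bk_algebra\<^esub> g) \<otimes>\<^bsub>Bk_algebra\<^esub> h = f \<otimes>\<^bsub>Bk_algebra\<^esub> (g \<otimes>\<^bsub>Bk_algebra\<^esub> h)"
    by (rule inj) (simp_all add: ps_mult_assoc)
  show "(f + g) \<otimes>\<^bsub>Bk_algebra\<^esub> h = f \<otimes>\<^bsub>Bk_algebra\<^esub> h + g \<otimes>\<^bsub>Bk_algebra\<^esub> h"
    by (rule inj) (simp_all add: ps_mult_add_left)
qed (simp_all add: Bk_algebra_mult_closed Bk_vec_in_carrier)

lemma algebra_iso_Bk:

  \<comment> \<open>Arbitrary linear maps with the prescribed values\<close>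
  assumes "linear_map \<rat>\<^sub>F Bk_algebra Sym \<phi>" "\<And>M. 0 \<notin># M \<Longrightarrow> \<phi> (Bk_vec M) = scaled_h M"
  shows "algebra_iso \<rat>\<^sub>F Bk_algebra Sym \<phi>"
proof -
  note eq = linear_map_eq_Bk_map[OF assms]
  have "\<phi> \<in> ring_iso Bk_algebra Sym"
  proof (rule ring_iso_memI)
    show "bij_betw \<phi> (carrier Bk_algebra) (carrier Sym)"
      using Bk_map_inj Bk_map_image bij_betw_cong[of "carrier Bk_algebra" \<phi> Bk_map] eq
      by (simp add: bij_betw_def cong: inj_on_cong image_cong)
    show "\<phi> \<one>\<^bsub>Bk_algebra\<^esub> = \<one>\<^bsub>Sym\<^esub>"
      using eq[of "Bk_vec {#}"] by (simp add: Bk_vec_in_carrier Bk_map_one)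
  qed (simp_all add: eq Bk_algebra_mult_closed Bk_map_mult Bk_map_add Bk_map_in_Sym[simplified]
      fspace.subspace_add[OF subspace_Bk_algebra])
  then show ?thesis
    using assms(1) algebra_Bk_algebra algebra_Sym by (simp add: algebra_iso_def)
qed

text \<open>Every multiset of positive parts is the multiset of block sizes of some \<pi> in \<Psi>,
  so prescribing values on the classes amounts to prescribing them on all
  \<open>Bk_vec M\<close>.\<close>

lemma prescribed_values_iff:
  "(\<forall>\<pi>\<in>\<Psi>. \<phi> (basis_vec Bk \<pi>) = (1 / fact (sp_size \<pi>)) \<odot>\<^bsub>Sym\<^esub> h_part (part_of_mset (Bk \<pi>)))
    \<longleftrightarrow> (\<forall>M. 0 \<notin># M \<longrightarrow> \<phi> (Bk_vec M) = scaled_h M)"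
proof -
  have "(\<phi> (basis_vec Bk \<pi>) = (1 / fact (sp_size \<pi>)) \<odot>\<^bsub>Sym\<^esub> h_part (part_of_mset (Bk \<pi>)))
      \<longleftrightarrow> \<phi> (Bk_vec (Bk \<pi>)) = scaled_h (Bk \<pi>)" if "\<pi> \<in> \<Psi>" for \<pi>
    using sum_mset_Bk[OF that] basis_vec_Bk[of \<pi>]
    by (simp add: scaled_h_def h_part_eq part_of_mset_def)
  then show ?thesis
    using Bk_pos set_partition_with_Bk by metis
qed

theorem theorem5p16:
  shows "shuffle_compatible Bk \<and>
    (\<exists>\<phi>. linear_map \<rat>\<^sub>F (shuffle_algebra Bk) Sym \<phi> \<and>
      (\<forall>\<pi>\<in>\<Psi>. \<phi> (basis_vec Bk \<pi>) =
        (1 / fact (sp_size \<pi>)) \<odot>\<^bsub>Sym\<^esub> h_part (part_of_mset (Bk \<pi>)))) \<and>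
    (\<forall>\<phi>. linear_map \<rat>\<^sub>F (shuffle_algebra Bk) Sym \<phi> \<and>
      (\<forall>\<pi>\<in>\<Psi>. \<phi> (basis_vec Bk \<pi>) =
        (1 / fact (sp_size \<pi>)) \<odot>\<^bsub>Sym\<^esub> h_part (part_of_mset (Bk \<pi>)))
      \<longrightarrow> algebra_iso \<rat>\<^sub>F (shuffle_algebra Bk) Sym \<phi>)"
  unfolding prescribed_values_iff
proof (intro conjI allI impI)
  show "\<exists>\<phi>. linear_map \<rat>\<^sub>F Bk_algebra Sym \<phi> \<and> (\<forall>M. 0 \<notin># M \<longrightarrow> \<phi> (Bk_vec M) = scaled_h M)"
    using linear_Bk_map Bk_map_vec by (intro exI[of _ Bk_map]) simp
qed (simp_all add: shuffle_compatible_Bk algebra_iso_Bk)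

end
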